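(* For every integer $q\geq 3$ and every non-negative integer $d$, we have $R_{d,q}\leq m_q q^d$, where $m_q=\frac{2q(q^2+4q+1)}{(q-1)^4}$.
   Context: A function $f:\mathbb{Z}_q^n\to\{0,1\}$ ($n$ a positive integer) is called Boolean. Identify $\mathbb{Z}_q$ with $\{0,1,\ldots,q-1\}\subset\mathbb{R}$. Every function $f:\mathbb{Z}_q^n\to\mathbb{R}$ has a unique representation $f=\sum_{u\in\{0,\ldots,q-1\}^n}\alpha_u x^u$ with $\alpha_u\in\mathbb{R}$ and $x^u=x_1^{u_1}\cdots x_n^{u_n}$ (a real polynomial of degree at most $q-1$ in each variable, agreeing with $f$ on $\{0,\ldots,q-1\}^n$). For $u\in\mathbb{Z}_q^n$, the weight $|u|$ is the number of non-zero coordinates of $u$. The degree of $f$ is $\deg(f)=\max\{|u|:\alpha_u\neq 0\}$ (and $\deg(f)=0$ if $f\equiv 0$); equivalently, it is the smallest $t\ge 0$ such that $f$ is a sum of functions each depending on at most $t$ variables. A variable $x_i$ is relevant for $f$ if there are $x,y\in\mathbb{Z}_q^n$ differing only in position $i$ with $f(x)\neq f(y)$; $R(f)$ is the number of relevant variables of $f$. $R_{d,q}$ is the maximum of $R(f)$ over all $n$ and all Boolean functions $f$ on $\mathbb{Z}_q^n$ of degree at most $d$. *)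

theory Defs
  imports "HOL-Analysis.Analysis" "HOL-Computational_Algebra.Polynomial"
begin

text \<open>
  The set \<open>grid n q\<close> is \<open>\<int>\<^sub>q\<^sup>n\<close>, with \<open>\<int>\<^sub>q\<close> identified with \<open>{0, \<dots>, q - 1}\<close> and coordinates
  indexed by \<open>0, \<dots>, n - 1\<close>. A function on \<open>\<int>\<^sub>q\<^sup>n\<close> is a function on \<open>nat \<Rightarrow> nat\<close> of which only
  the values on the grid are ever used. The same set also serves as the set of exponent vectors.
\<close>

definition grid :: "nat \<Rightarrow> nat \<Rightarrow> (nat \<Rightarrow> nat) set" where
  "grid n q = ({..<n} \<rightarrow>\<^sub>E {..<q})"

definition boolean_fun :: "nat \<Rightarrow> nat \<Rightarrow> ((nat \<Rightarrow> nat) \<Rightarrow> real) \<Rightarrow> bool" where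
  "boolean_fun n q f \<longleftrightarrow> (\<forall>x\<in>grid n q. f x \<in> {0, 1})"

definition monomial :: "nat \<Rightarrow> (nat \<Rightarrow> nat) \<Rightarrow> (nat \<Rightarrow> nat) \<Rightarrow> real" where
  "monomial n u x = (\<Prod>i<n. real (x i) ^ u i)"

text \<open>The condition outside the grid only serves to make the family of coefficients unique.\<close>

definition represents ::
    "nat \<Rightarrow> nat \<Rightarrow> ((nat \<Rightarrow> nat) \<Rightarrow> real) \<Rightarrow> ((nat \<Rightarrow> nat) \<Rightarrow> real) \<Rightarrow> bool" where
  "represents n q \<alpha> f \<longleftrightarrow>
     (\<forall>u. u \<notin> grid n q \<longrightarrow> \<alpha> u = 0) \<and>
     (\<forall>x\<in>grid n q. f x = (\<Sum>u\<in>grid n q. \<alpha> u * monomial n u x))"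

text \<open>Well defined by the lemma \<open>represents_ex1\<close> below.\<close>

definition coeffs ::
    "nat \<Rightarrow> nat \<Rightarrow> ((nat \<Rightarrow> nat) \<Rightarrow> real) \<Rightarrow> (nat \<Rightarrow> nat) \<Rightarrow> real" where
  "coeffs n q f = (THE \<alpha>. represents n q \<alpha> f)"

definition weight :: "nat \<Rightarrow> (nat \<Rightarrow> nat) \<Rightarrow> nat" where
  "weight n u = card {i. i < n \<and> u i \<noteq> 0}"

text \<open>Inserting \<open>0\<close> changes the maximum only for the zero function, whose degree is \<open>0\<close>.\<close>

definition deg :: "nat \<Rightarrow> nat \<Rightarrow> ((nat \<Rightarrow> nat) \<Rightarrow> real) \<Rightarrow> nat" where
  "deg n q f = Max (insert 0 (weight n ` {u \<in> grid n q. coeffs n q f u \<noteq> 0}))"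

definition relevant :: "nat \<Rightarrow> nat \<Rightarrow> ((nat \<Rightarrow> nat) \<Rightarrow> real) \<Rightarrow> nat \<Rightarrow> bool" where
  "relevant n q f i \<longleftrightarrow>
     (\<exists>x\<in>grid n q. \<exists>y\<in>grid n q. x i \<noteq> y i \<and> (\<forall>j<n. j \<noteq> i \<longrightarrow> x j = y j) \<and> f x \<noteq> f y)"

definition num_relevant :: "nat \<Rightarrow> nat \<Rightarrow> ((nat \<Rightarrow> nat) \<Rightarrow> real) \<Rightarrow> nat" where
  "num_relevant n q f = card {i. i < n \<and> relevant n q f i}"

text \<open>
  The maximum is taken as a supremum in \<^typ>\<open>enat\<close>, so that finiteness is not presupposed:
  the value is \<open>\<infinity>\<close> if the numbers of relevant variables are unbounded, and otherwise it is
  attained (lemma \<open>max_relevant_attained\<close>).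
\<close>

definition max_relevant :: "nat \<Rightarrow> nat \<Rightarrow> enat" where
  "max_relevant d q =
     Sup {enat (num_relevant n q f) | n f. n > 0 \<and> boolean_fun n q f \<and> deg n q f \<le> d}"


subsection \<open>Existence and uniqueness of the polynomial representation\<close>

lemma finite_grid [simp]: "finite (grid n q)"
  unfolding grid_def by (intro finite_PiE) auto

lemma lagrange_ex:
  assumes "k < q"
  shows "\<exists>p :: real poly. degree p < q \<and> (\<forall>j<q. poly p (real j) = of_bool (j = k))"
proof -
  define P :: "real poly" where "P = (\<Prod>j\<in>{..<q} - {k}. [:- real j, 1:])"
  have "degree P \<le> (\<Sum>j\<in>{..<q} - {k}. degree [:- real j, 1:])"
    unfolding P_def using degree_prod_sum_le[of "{..<q} - {k}" "\<lambda>j. [:- real j, 1:]"]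
    by (simp add: o_def)
  also have "\<dots> = q - 1"
    using assms by simp
  finally have deg: "degree P < q" using assms by simp
  have nz: "poly P (real k) \<noteq> 0"
    unfolding P_def poly_prod by (subst prod_zero_iff) auto
  have z: "poly P (real j) = 0" if "j < q" "j \<noteq> k" for j
    unfolding P_def poly_prod using that by (subst prod_zero_iff) auto
  show ?thesis
    using deg nz z by (intro exI[of _ "smult (1 / poly P (real k)) P"]) auto
qed

definition lagrange :: "nat \<Rightarrow> nat \<Rightarrow> real poly" where
  "lagrange q k = (SOME p. degree p < q \<and> (\<forall>j<q. poly p (real j) = of_bool (j = k)))"

lemma
  assumes "k < q"
  shows degree_lagrange: "degree (lagrange q k) < q"
    and poly_lagrange: "j < q \<Longrightarrow> poly (lagrange q k) (real j) = of_bool (j = k)"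
  using someI_ex[OF lagrange_ex[OF assms]] unfolding lagrange_def by auto

lemma lagrange_sum:
  assumes "k < q" "j < q"
  shows "(\<Sum>u<q. coeff (lagrange q k) u * real j ^ u) = of_bool (j = k)"
proof -
  have "poly (lagrange q k) (real j) = (\<Sum>u<q. coeff (lagrange q k) u * real j ^ u)"
    unfolding poly_altdef
    by (intro sum.mono_neutral_left)
       (use degree_lagrange[OF assms(1)] in \<open>auto simp: coeff_eq_0\<close>)
  with poly_lagrange[OF assms] show ?thesis by simp
qed

lemma lagrange_dual:
  assumes "v < q" "u < q"
  shows "(\<Sum>k<q. coeff (lagrange q k) u * real k ^ v) = of_bool (u = v)"
proof -
  define P where "P = (\<Sum>k<q. smult (real k ^ v) (lagrange q k))"
  have "P = monom 1 v"
  proof (rule poly_eqI_degree[where A = "real ` {..<q}"])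
    fix x assume "x \<in> real ` {..<q}"
    then obtain j where j: "j < q" "x = real j" by auto
    have "poly P x = (\<Sum>k<q. real k ^ v * of_bool (j = k))"
      unfolding P_def poly_sum j(2) using j(1) by (intro sum.cong) (auto simp: poly_lagrange)
    also have "\<dots> = real j ^ v"
      using j(1) by (subst sum.remove[of _ j]) auto
    finally show "poly P x = poly (monom 1 v) x" by (simp add: j(2) poly_monom)
  next
    have "degree P \<le> q - 1"
      unfolding P_def
      by (intro degree_sum_le order.trans[OF degree_smult_le])
         (use degree_lagrange in \<open>fastforce+\<close>)
    with assms show "degree P < card (real ` {..<q})"
      by (simp add: card_image)
    show "degree (monom (1::real) v) < card (real ` {..<q})"
      using assms by (simp add: card_image degree_monom_eq)
  qed
  then have "coeff P u = of_bool (u = v)" by simp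
  then show ?thesis unfolding P_def by (simp add: coeff_sum mult.commute)
qed

lemma prod_of_bool_grid:
  assumes "a \<in> grid n q" "x \<in> grid n q"
  shows "(\<Prod>i<n. of_bool (x i = a i) :: real) = of_bool (x = a)"
proof (cases "x = a")
  case False
  then obtain i where "i < n" "x i \<noteq> a i"
    using assms unfolding grid_def by (metis PiE_ext lessThan_iff)
  then have "(\<Prod>i<n. of_bool (x i = a i) :: real) = 0"
    by (intro prod_zero) auto
  with False show ?thesis by simp
qed auto

lemma grid_lagrange_sum:
  assumes "a \<in> grid n q" "x \<in> grid n q"
  shows "(\<Sum>u\<in>grid n q. (\<Prod>i<n. coeff (lagrange q (a i)) (u i)) * monomial n u x) = of_bool (x = a)"
proof -
  have lt: "a i < q" "x i < q" if "i < n" for i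
    using assms that by (auto simp: grid_def dest!: PiE_mem)
  have "(\<Sum>u\<in>grid n q. (\<Prod>i<n. coeff (lagrange q (a i)) (u i)) * monomial n u x) =
        (\<Prod>i<n. \<Sum>k<q. coeff (lagrange q (a i)) k * real (x i) ^ k)"
    by (simp add: grid_def prod_sum_PiE monomial_def prod.distrib)
  also have "\<dots> = (\<Prod>i<n. of_bool (x i = a i))"
    using lt by (intro prod.cong) (auto simp: lagrange_sum)
  finally show ?thesis using prod_of_bool_grid[OF assms] by simp
qed

lemma grid_lagrange_dual:
  assumes "u \<in> grid n q" "v \<in> grid n q"
  shows "(\<Sum>a\<in>grid n q. (\<Prod>i<n. coeff (lagrange q (a i)) (u i)) * monomial n v a) = of_bool (u = v)"
proof -
  have lt: "u i < q" "v i < q" if "i < n" for i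
    using assms that by (auto simp: grid_def dest!: PiE_mem)
  have "(\<Sum>a\<in>grid n q. (\<Prod>i<n. coeff (lagrange q (a i)) (u i)) * monomial n v a) =
        (\<Prod>i<n. \<Sum>k<q. coeff (lagrange q k) (u i) * real k ^ v i)"
    by (simp add: grid_def prod_sum_PiE monomial_def prod.distrib)
  also have "\<dots> = (\<Prod>i<n. of_bool (u i = v i))"
    using lt by (intro prod.cong) (auto simp: lagrange_dual)
  finally show ?thesis using prod_of_bool_grid[OF assms(2,1)] by simp
qed

lemma represents_ex1: "\<exists>!\<alpha>. represents n q \<alpha> f"
proof
  let ?G = "grid n q"
  let ?L = "\<lambda>a u. \<Prod>i<n. coeff (lagrange q (a i)) (u i)"
  define \<alpha> where "\<alpha> = (\<lambda>u. if u \<in> ?G then \<Sum>a\<in>?G. f a * ?L a u else 0)"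
  show "represents n q \<alpha> f"
    unfolding represents_def
  proof (intro conjI allI impI ballI)
    fix x assume x: "x \<in> ?G"
    have "(\<Sum>u\<in>?G. \<alpha> u * monomial n u x) = (\<Sum>u\<in>?G. \<Sum>a\<in>?G. f a * (?L a u * monomial n u x))"
      by (simp add: \<alpha>_def sum_distrib_right mult.assoc)
    also have "\<dots> = (\<Sum>a\<in>?G. f a * (\<Sum>u\<in>?G. ?L a u * monomial n u x))"
      by (subst sum.swap) (simp add: sum_distrib_left)
    also have "\<dots> = (\<Sum>a\<in>?G. f a * of_bool (x = a))"
      using x by (intro sum.cong refl) (simp add: grid_lagrange_sum)
    also have "\<dots> = f x"
      using x by (subst sum.remove[of _ x]) auto
    finally show "f x = (\<Sum>u\<in>?G. \<alpha> u * monomial n u x)" ..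
  qed (simp add: \<alpha>_def)
  fix \<beta> assume \<beta>: "represents n q \<beta> f"
  show "\<beta> = \<alpha>"
  proof
    fix u
    show "\<beta> u = \<alpha> u"
    proof (cases "u \<in> ?G")
      case True
      have "\<alpha> u = (\<Sum>a\<in>?G. (\<Sum>v\<in>?G. \<beta> v * monomial n v a) * ?L a u)"
        using \<beta> True by (simp add: \<alpha>_def represents_def)
      also have "\<dots> = (\<Sum>a\<in>?G. \<Sum>v\<in>?G. \<beta> v * (?L a u * monomial n v a))"
        by (simp add: sum_distrib_left mult_ac)
      also have "\<dots> = (\<Sum>v\<in>?G. \<beta> v * (\<Sum>a\<in>?G. ?L a u * monomial n v a))"
        by (subst sum.swap) (simp add: sum_distrib_left)
      also have "\<dots> = (\<Sum>v\<in>?G. \<beta> v * of_bool (u = v))"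
        using True by (intro sum.cong refl) (simp add: grid_lagrange_dual)
      also have "\<dots> = \<beta> u"
        using True by (subst sum.remove[of _ u]) auto
      finally show ?thesis ..
    next
      case False
      with \<beta> show ?thesis by (simp add: \<alpha>_def represents_def)
    qed
  qed
qed

lemma represents_coeffs: "represents n q (coeffs n q f) f"
  unfolding coeffs_def by (rule theI'[OF represents_ex1])

lemma coeffs_eqI: "represents n q \<alpha> f \<Longrightarrow> coeffs n q f = \<alpha>"
  using represents_ex1 represents_coeffs by blast

lemma max_relevant_attained:
  assumes "max_relevant d q = enat m"
  shows "\<exists>n f. n > 0 \<and> boolean_fun n q f \<and> deg n q f \<le> d \<and> num_relevant n q f = m"
proof -
  define S where "S = {enat (num_relevant n q f) | n f. n > 0 \<and> boolean_fun n q f \<and> deg n q f \<le> d}"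
  have "represents 1 q (\<lambda>_. 0) (\<lambda>_. 0)" by (simp add: represents_def)
  then have "deg 1 q (\<lambda>_. 0) = 0" by (simp add: deg_def coeffs_eqI)
  moreover have "boolean_fun 1 q (\<lambda>_. 0)" by (simp add: boolean_fun_def)
  ultimately have ne: "S \<noteq> {}" unfolding S_def by (force intro: exI[of _ 1])
  from assms ne have "finite S" "Max S = enat m"
    unfolding max_relevant_def S_def[symmetric] Sup_enat_def by (simp_all split: if_splits)
  with ne have "enat m \<in> S" using Max_in by metis
  then show ?thesis unfolding S_def by auto
qed

end

(*
  Give every relevant variable x_i the weight q^(-e), where e is the largest size of the support of a
  monomial of f containing x_i; it suffices to bound the sum W(f) of the weights. Averaged over the
  q values of a variable x_j, the weight of another variable x_i does not decrease when x_j is fixed.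
  Let d = deg f, and let H be the union of a maximal family of pairwise disjoint supports of size d.
  Every support of size d meets H, so fixing the variables in H lowers the degree, while each variable
  in H has weight q^(-d); hence W(f) <= |H| q^(-d) + W', with W' the bound for degree d - 1.

  The family has fewer than 2 d^2 members, hence |H| <= 2 d^3 and W(f) <= sum_k 2 k^3 q^(-k): on each
  member M, f can be changed at any given point x by modifying x on M only, since f with the variables
  outside M fixed still has a monomial with support M. Switching these modifications on and off
  gives a Boolean function of degree at most d on the subsets Z of a k-element set, which differs on
  all singletons from its value at the empty set. Averaging over all Z with |Z| = j gives a real
  polynomial p(j) of degree at most d with values in [0, 1] at j = 0, ..., k and |p(0) - p(1)| = 1.
  The divided difference of p at the d + 2 nodes 0, 1 and 2 m^2 (m = 1, ..., d) vanishes; but if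
  k >= 2 d^2, then the weights of the nodes 0 and 1 are too large for this.
*)
theory Submission
  imports Defs
begin

section \<open>Divided differences at the nodes \<open>0, 1, 2, 8, \<dots>, 2d\<^sup>2\<close>\<close>

text \<open>The sum is the coefficient of degree \<open>card X - 1\<close> of the Lagrange
  interpolant \<open>L\<close> of \<open>p\<close> on \<open>X\<close>. Both have degree below
  \<open>card X\<close>, so \<open>L = p\<close>, and that coefficient of \<open>p\<close> is
  0.\<close>

lemma divided_difference_eq_0:
  fixes p :: "real poly"
  assumes "finite X" and "degree p + 1 < card X"
  shows "(\<Sum>x\<in>X. poly p x / (\<Prod>y\<in>X - {x}. x - y)) = 0"
proof -
  define c where "c = (\<lambda>x. poly p x / (\<Prod>y\<in>X - {x}. x - y))"
  define B where "B = (\<lambda>x. \<Prod>y\<in>X - {x}. [:- y, 1:])"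
  define L where "L = (\<Sum>x\<in>X. smult (c x) (B x))"
  have degB: "degree (B x) = card X - 1" if "x \<in> X" for x
    using assms(1) that by (simp add: B_def degree_prod_eq_sum_degree)
  have leadB: "coeff (B x) (card X - 1) = 1" if "x \<in> X" for x
  proof -
    have "lead_coeff (B x) = 1" by (simp add: B_def lead_coeff_prod)
    with degB[OF that] show ?thesis by simp
  qed
  have "L = p"
  proof (rule poly_eqI_degree[where A = X])
    fix z assume z: "z \<in> X"
    have nz: "(\<Prod>y\<in>X - {z}. z - y) \<noteq> 0" using assms(1) by simp
    have "poly L z = (\<Sum>x\<in>X. c x * (\<Prod>y\<in>X - {x}. z - y))"
      by (simp add: L_def B_def poly_sum poly_prod)
    also have "\<dots> = c z * (\<Prod>y\<in>X - {z}. z - y)"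
    proof (subst sum.remove[OF assms(1) z])
      have "(\<Sum>x\<in>X - {z}. c x * (\<Prod>y\<in>X - {x}. z - y)) = 0"
        using assms(1) z by (intro sum.neutral) (auto intro!: prod_zero)
      then show "c z * (\<Prod>y\<in>X - {z}. z - y) + (\<Sum>x\<in>X - {z}. c x * (\<Prod>y\<in>X - {x}. z - y))
        = c z * (\<Prod>y\<in>X - {z}. z - y)" by simp
    qed
    also have "\<dots> = poly p z" using nz by (simp add: c_def)
    finally show "poly L z = poly p z" .
  next
    have "degree L \<le> card X - 1"
      unfolding L_def using assms(1) degB
      by (intro degree_sum_le order.trans[OF degree_smult_le]) auto
    with assms(2) show "degree L < card X" by simp
    show "degree p < card X" using assms(2) by simp
  qed
  then have "coeff L (card X - 1) = 0"
    using assms(2) by (simp add: coeff_eq_0)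
  moreover have "coeff L (card X - 1) = (\<Sum>x\<in>X. c x)"
    using leadB by (simp add: L_def coeff_sum)
  ultimately show ?thesis by (simp add: c_def)
qed

section \<open>Factorial estimates for products of differences of squares\<close>

lemma prod_add_eq_fact:
  "(\<Prod>l=1..j. real m + real l) = fact (m + j) / fact m"
  by (induction j) (simp_all add: algebra_simps)

lemma prod_diff_eq_fact:
  assumes "j < m"
  shows "(\<Prod>l=1..j. real m - real l) = fact (m - 1) / fact (m - 1 - j)"
  using assms
proof (induction j)
  case (Suc j)
  then obtain i where i: "m = Suc (Suc j + i)" using less_imp_Suc_add by blast
  have "(\<Prod>l=1..Suc j. real m - real l) = fact (m - 1) / fact (m - 1 - j) * (real m - real (Suc j))"
    using Suc by simp
  also have "\<dots> = fact (m - 1) / fact (m - 1 - Suc j)"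
    unfolding i by (simp add: Suc_diff_le divide_simps)
  finally show ?case .
qed simp

text \<open>For \<open>d = m\<close> the factors split as (m - l)(m + l) and collect into
  factorials; raising \<open>d\<close> by one multiplies both sides by (d + 1 - m)(d + 1 + m) / (d +
  1)^2. The value is C(2d, d) / (2 C(2d, d + m)).\<close>

lemma prod_abs_square_diff:
  assumes "1 \<le> m" "m \<le> d"
  shows "(\<Prod>l\<in>{1..d} - {m}. \<bar>(real l)\<^sup>2 - (real m)\<^sup>2\<bar> / (real l)\<^sup>2)
       = fact (d - m) * fact (d + m) / (2 * (fact d)\<^sup>2)"
  using assms(2)
proof (induction d rule: dec_induct)
  case base
  obtain i where i: "m = Suc i" using assms(1) by (cases m) auto
  have "{1..m} - {m} = {1..i}" by (auto simp: i)
  then have "(\<Prod>l\<in>{1..m} - {m}. \<bar>(real l)\<^sup>2 - (real m)\<^sup>2\<bar> / (real l)\<^sup>2)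
     = (\<Prod>l=1..i. (real m + real l) * (real m - real l) / (real l)\<^sup>2)"
  proof (rule prod.cong)
    fix l assume "l \<in> {1..i}"
    then have "(real l)\<^sup>2 \<le> (real m)\<^sup>2" by (intro power_mono) (auto simp: i)
    then show "\<bar>(real l)\<^sup>2 - (real m)\<^sup>2\<bar> / (real l)\<^sup>2 = (real m + real l) * (real m - real l) / (real l)\<^sup>2"
      by (simp add: power2_eq_square algebra_simps)
  qed
  also have "\<dots> = (fact (m + i) / fact m) * (fact i / fact 0) / (\<Prod>l=1..i. real l)\<^sup>2"
    unfolding prod_dividef prod.distrib prod_add_eq_fact
    using prod_diff_eq_fact[of i m] by (simp add: i prod_power_distrib)
  also have "(\<Prod>l=1..i. real l) = fact i"
    by (simp add: fact_prod)
  also have "(fact (m + i) / fact m) * (fact i / fact 0) / (fact i)\<^sup>2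
      = fact (m - m) * fact (m + m) / (2 * (fact m)\<^sup>2 :: real)"
    by (simp add: i power2_eq_square divide_simps)
  finally show ?case .
next
  case (step d)
  obtain i where i: "d = m + i" using step.hyps le_Suc_ex by blast
  have "{1..Suc d} - {m} = insert (Suc d) ({1..d} - {m})"
    using step.hyps by auto
  then have "(\<Prod>l\<in>{1..Suc d} - {m}. \<bar>(real l)\<^sup>2 - (real m)\<^sup>2\<bar> / (real l)\<^sup>2)
     = \<bar>(real (Suc d))\<^sup>2 - (real m)\<^sup>2\<bar> / (real (Suc d))\<^sup>2
       * (fact (d - m) * fact (d + m) / (2 * (fact d)\<^sup>2))"
    using step.IH by simp
  also have "\<bar>(real (Suc d))\<^sup>2 - (real m)\<^sup>2\<bar> = (real i + 1) * (real d + real m + 1)"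
    by (simp add: i power2_eq_square algebra_simps)
  also have "(real i + 1) * (real d + real m + 1) / (real (Suc d))\<^sup>2
       * (fact (d - m) * fact (d + m) / (2 * (fact d)\<^sup>2))
      = fact (Suc d - m) * fact (Suc d + m) / (2 * (fact (Suc d))\<^sup>2)"
    by (simp add: i Suc_diff_le power2_eq_square divide_simps) (simp add: algebra_simps)
  finally show ?case .
qed

text \<open>Equivalent to C(2d, d + m) being at most the central coefficient C(2d, d).\<close>

lemma fact_square_le:
  assumes "m \<le> d"
  shows "(fact d)\<^sup>2 \<le> (fact (d - m) * fact (d + m) :: real)"
  using assms
proof (induction m)
  case (Suc m)
  then obtain i where i: "d = Suc m + i" using le_Suc_ex by blast
  have "(fact d)\<^sup>2 \<le> (fact (d - m) * fact (d + m) :: real)" using Suc by simp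
  also have "\<dots> = fact (d - Suc m) * (real (i + 1) * fact (d + m))"
    by (simp add: i)
  also have "\<dots> \<le> fact (d - Suc m) * (real (d + m + 1) * fact (d + m))"
    by (intro mult_left_mono mult_right_mono) (auto simp: i)
  finally show ?case by (simp add: algebra_simps)
qed (simp add: power2_eq_square)

lemma prod_abs_square_diff_ge:
  assumes "1 \<le> m" "m \<le> d"
  shows "(\<Prod>l\<in>{1..d} - {m}. \<bar>(real l)\<^sup>2 - (real m)\<^sup>2\<bar>) \<ge> (\<Prod>l\<in>{1..d} - {m}. (real l)\<^sup>2) / 2"
proof -
  have pos: "(\<Prod>l\<in>{1..d} - {m}. (real l)\<^sup>2) > 0" by (intro prod_pos) auto
  have "1 / 2 \<le> fact (d - m) * fact (d + m) / (2 * (fact d)\<^sup>2 :: real)"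
    using fact_square_le[OF assms(2)] by (simp add: divide_simps)
  then show ?thesis
    using pos unfolding prod_abs_square_diff[OF assms, symmetric] prod_dividef
    by (simp add: field_simps)
qed

text \<open>The terms are dominated by a telescoping series. The subtracted fractions make the
  induction go through, and 11/4 gives equality at \<open>d = 1\<close>; what matters later is that
  it is below 3.\<close>

lemma sum_two_over_le:
  assumes "1 \<le> d"
  shows "(\<Sum>m=1..d. 2 / (2 * (real m)\<^sup>2 - 1)) \<le> 11 / 4 - 1 / (2 * real d) - 1 / (2 * (real d + 1))"
  using assms
proof (induction d rule: dec_induct)
  case (step d)
  have d: "real d \<ge> 1" using step.hyps by simp
  have pos: "2 * (real d + 1)\<^sup>2 - 1 > 0" "real d * (real d + 2) > 0"
    using d by (auto simp: power2_eq_square algebra_simps intro: add_pos_nonneg)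
  have "2 / (2 * (real d + 1)\<^sup>2 - 1) \<le> 1 / (real d * (real d + 2))"
    using pos d by (simp add: divide_simps) (simp add: power2_eq_square algebra_simps)
  also have "\<dots> = 1 / (2 * real d) - 1 / (2 * (real d + 2))"
    using d by (simp add: divide_simps)
  finally show ?case using step by (simp add: add.commute)
qed simp

text \<open>The factors at \<open>m = 1\<close> are 1 and 2 and already give the ratio 2; every
  other factor only increases it.\<close>

lemma prod_ratio_ge_2:
  assumes "1 \<le> d"
  shows "2 * (\<Prod>m=1..d. 2 * (real m)\<^sup>2 - 1) \<le> (\<Prod>m=1..d. 2 * (real m)\<^sup>2)"
  using assms
proof (induction d rule: dec_induct)
  case (step d)
  have pos: "(\<Prod>m=1..d. 2 * (real m)\<^sup>2) \<ge> 0" by (intro prod_nonneg) auto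
  have sq: "2 * (real (Suc d))\<^sup>2 - 1 \<ge> 0" by (simp add: power2_eq_square algebra_simps)
  have "2 * (\<Prod>m=1..Suc d. 2 * (real m)\<^sup>2 - 1)
      = 2 * (\<Prod>m=1..d. 2 * (real m)\<^sup>2 - 1) * (2 * (real (Suc d))\<^sup>2 - 1)" by simp
  also have "\<dots> \<le> (\<Prod>m=1..d. 2 * (real m)\<^sup>2) * (2 * (real (Suc d))\<^sup>2 - 1)"
    using step.IH sq by (rule mult_right_mono)
  also have "\<dots> \<le> (\<Prod>m=1..d. 2 * (real m)\<^sup>2) * (2 * (real (Suc d))\<^sup>2)"
    using pos by (intro mult_left_mono) auto
  finally show ?case by simp
qed simp

section \<open>The interpolation nodes and their weights\<close>

text \<open>The nodes 0 and 1 carry the jump of the polynomial; the quadratic spacing of the others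
  keeps their weights small. The largest node for d >= 1, 2 d^2, is the origin of the bound on the
  number of blocks.\<close>

definition nodes :: "nat \<Rightarrow> nat set" where
  "nodes d = insert 0 (insert 1 ((\<lambda>m. 2 * m\<^sup>2) ` {1..d}))"

text \<open>These are the coefficients of the divided difference at the nodes.\<close>

definition node_weight :: "nat \<Rightarrow> nat \<Rightarrow> real" where
  "node_weight d x = 1 / (\<Prod>y\<in>nodes d - {x}. real x - real y)"

lemma finite_nodes [simp]: "finite (nodes d)"
  by (simp add: nodes_def)

lemma one_neq_two_times: "(1::nat) \<noteq> 2 * m"
  by presburger

lemma inj_nodes: "inj_on (\<lambda>m::nat. 2 * m\<^sup>2) S"
  by (auto simp: inj_on_def)

lemma nodes_new: "0 \<notin> (\<lambda>m::nat. 2 * m\<^sup>2) ` {1..d}" "Suc 0 \<notin> (\<lambda>m::nat. 2 * m\<^sup>2) ` {1..d}"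
  using one_neq_two_times by (auto simp: image_iff) 

lemma card_nodes: "card (nodes d) = d + 2"
  using nodes_new[of d] by (simp add: nodes_def card_image inj_nodes)

lemma sum_node_weight_poly:
  assumes "degree p \<le> d"
  shows "(\<Sum>x\<in>nodes d. node_weight d x * poly p (real x)) = 0"
proof -
  have inj: "inj_on real (nodes d)" by (simp add: inj_on_def)
  have eq: "(\<Prod>y\<in>real ` nodes d - {real x}. real x - y) = (\<Prod>y\<in>nodes d - {x}. real x - real y)" for x
  proof -
    have "real ` nodes d - {real x} = real ` (nodes d - {x})" by auto
    then show ?thesis by (simp add: prod.reindex inj_on_def)
  qed
  have "(\<Sum>x\<in>real ` nodes d. poly p x / (\<Prod>y\<in>real ` nodes d - {x}. x - y)) = 0"
    using assms by (intro divided_difference_eq_0) (simp_all add: card_image inj card_nodes)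
  then show ?thesis
    by (simp add: sum.reindex inj eq node_weight_def)
qed

lemma node_weight_0: "node_weight d 0 = (-1) ^ Suc d / (\<Prod>m=1..d. 2 * (real m)\<^sup>2)"
proof -
  have "nodes d - {0} = insert 1 ((\<lambda>m. 2 * m\<^sup>2) ` {1..d})"
    using nodes_new[of d] by (auto simp: nodes_def)
  then have "(\<Prod>y\<in>nodes d - {0}. real 0 - real y) = - (\<Prod>m=1..d. - (2 * (real m)\<^sup>2))"
    using nodes_new[of d] by (simp add: prod.reindex inj_nodes)
  also have "(\<Prod>m=1..d. - (2 * (real m)\<^sup>2)) = (-1) ^ d * (\<Prod>m=1..d. 2 * (real m)\<^sup>2)"
    by (subst prod_uminus) simp
  finally show ?thesis by (cases "even d") (simp_all add: node_weight_def)
qed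

lemma node_weight_1: "node_weight d 1 = (-1) ^ d / (\<Prod>m=1..d. 2 * (real m)\<^sup>2 - 1)"
proof -
  have "nodes d - {1} = insert 0 ((\<lambda>m. 2 * m\<^sup>2) ` {1..d})"
    using nodes_new[of d] by (auto simp: nodes_def)
  then have "(\<Prod>y\<in>nodes d - {1}. real 1 - real y) = (\<Prod>m=1..d. - (2 * (real m)\<^sup>2 - 1))"
    using nodes_new[of d] by (simp add: prod.reindex inj_nodes)
  also have "\<dots> = (-1) ^ d * (\<Prod>m=1..d. 2 * (real m)\<^sup>2 - 1)"
    by (subst prod_uminus) simp
  finally show ?thesis by (cases "even d") (simp_all add: node_weight_def)
qed

text \<open>The distances to 0 and 1 are 2 m^2 and 2 m^2 - 1, and those to the remaining nodes
  multiply to at least half of the product of 2 l^2 over \<open>l\<close> other than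
  \<open>m\<close>. The last factor on the right is the absolute weight of the node 0, which makes
  the weights comparable.\<close>

lemma abs_node_weight_le:
  assumes "1 \<le> m" "m \<le> d"
  shows "\<bar>node_weight d (2 * m\<^sup>2)\<bar> \<le> 2 / (2 * (real m)\<^sup>2 - 1) / (\<Prod>l=1..d. 2 * (real l)\<^sup>2)"
proof -
  let ?S = "{1..d} - {m}"
  have m1: "(real m)\<^sup>2 \<ge> 1" using assms by simp
  have "nodes d - {2 * m\<^sup>2} = insert 0 (insert 1 ((\<lambda>m. 2 * m\<^sup>2) ` ?S))"
    using assms nodes_new[of d] by (auto simp: nodes_def) 
  moreover have "0 \<notin> (\<lambda>m::nat. 2 * m\<^sup>2) ` ?S" "Suc 0 \<notin> (\<lambda>m::nat. 2 * m\<^sup>2) ` ?S"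
    using nodes_new[of d] by auto
  ultimately have "(\<Prod>y\<in>nodes d - {2 * m\<^sup>2}. real (2 * m\<^sup>2) - real y)
      = 2 * (real m)\<^sup>2 * ((2 * (real m)\<^sup>2 - 1) * (\<Prod>l\<in>?S. 2 * (real m)\<^sup>2 - 2 * (real l)\<^sup>2))"
    by (simp add: prod.reindex inj_nodes)
  also have "(\<Prod>l\<in>?S. 2 * (real m)\<^sup>2 - 2 * (real l)\<^sup>2)
      = 2 ^ (d - 1) * (\<Prod>l\<in>?S. (real m)\<^sup>2 - (real l)\<^sup>2)"
  proof -
    have "(\<Prod>l\<in>?S. 2 * (real m)\<^sup>2 - 2 * (real l)\<^sup>2) = (\<Prod>l\<in>?S. 2 * ((real m)\<^sup>2 - (real l)\<^sup>2))"
      by (simp add: algebra_simps)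
    also have "\<dots> = 2 ^ card ?S * (\<Prod>l\<in>?S. (real m)\<^sup>2 - (real l)\<^sup>2)"
      by (simp only: prod.distrib prod_constant)
    finally show ?thesis using assms by simp
  qed
  finally have "\<bar>\<Prod>y\<in>nodes d - {2 * m\<^sup>2}. real (2 * m\<^sup>2) - real y\<bar>
      = 2 * (real m)\<^sup>2 * ((2 * (real m)\<^sup>2 - 1) * (2 ^ (d - 1) * (\<Prod>l\<in>?S. \<bar>(real l)\<^sup>2 - (real m)\<^sup>2\<bar>)))"
    using m1 by (simp add: abs_mult abs_prod abs_minus_commute[of "(real m)\<^sup>2"] abs_of_nonneg)
  also have "\<dots> \<ge> 2 * (real m)\<^sup>2 * ((2 * (real m)\<^sup>2 - 1) * (2 ^ (d - 1) * ((\<Prod>l\<in>?S. (real l)\<^sup>2) / 2)))"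
    using m1 prod_abs_square_diff_ge[OF assms] by (intro mult_left_mono) auto
  also have "2 * (real m)\<^sup>2 * ((2 * (real m)\<^sup>2 - 1) * (2 ^ (d - 1) * ((\<Prod>l\<in>?S. (real l)\<^sup>2) / 2)))
      = (2 * (real m)\<^sup>2 - 1) * (2 * (real m)\<^sup>2 * (2 ^ (d - 1) * (\<Prod>l\<in>?S. (real l)\<^sup>2))) / 2"
    by simp
  also have "2 * (real m)\<^sup>2 * (2 ^ (d - 1) * (\<Prod>l\<in>?S. (real l)\<^sup>2)) = (\<Prod>l=1..d. 2 * (real l)\<^sup>2)"
  proof -
    have "(\<Prod>l=1..d. 2 * (real l)\<^sup>2) = 2 * (real m)\<^sup>2 * (\<Prod>l\<in>?S. 2 * (real l)\<^sup>2)"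
      using assms by (intro prod.remove) auto
    also have "(\<Prod>l\<in>?S. 2 * (real l)\<^sup>2) = 2 ^ card ?S * (\<Prod>l\<in>?S. (real l)\<^sup>2)"
      by (simp only: prod.distrib prod_constant)
    finally show ?thesis using assms by simp
  qed
  finally have lower: "\<bar>\<Prod>y\<in>nodes d - {2 * m\<^sup>2}. real (2 * m\<^sup>2) - real y\<bar>
      \<ge> (2 * (real m)\<^sup>2 - 1) * (\<Prod>l=1..d. 2 * (real l)\<^sup>2) / 2" .
  have pos: "(2 * (real m)\<^sup>2 - 1) * (\<Prod>l=1..d. 2 * (real l)\<^sup>2) / 2 > 0"
    using m1 by (intro divide_pos_pos mult_pos_pos prod_pos) auto
  show ?thesis
    using frac_le[OF zero_le_one order.refl pos lower] by (simp add: node_weight_def)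
qed

text \<open>In units of 1/A, the absolute weight of node 0, the right side is at least 1 + 2 = 3,
  while the left side is at most 11/4.\<close>

lemma node_weight_dominance:
  assumes "1 \<le> d"
  shows "(\<Sum>m=1..d. \<bar>node_weight d (2 * m\<^sup>2)\<bar>) < \<bar>node_weight d 0 - node_weight d 1\<bar>"
proof -
  define A where "A = (\<Prod>m=1..d. 2 * (real m)\<^sup>2)"
  define B where "B = (\<Prod>m=1..d. 2 * (real m)\<^sup>2 - 1)"
  have A: "A > 0" unfolding A_def by (intro prod_pos) auto
  have B: "B > 0"
  proof -
    have "2 * (real m)\<^sup>2 - 1 > 0" if "1 \<le> m" for m
    proof -
      have "(real m)\<^sup>2 \<ge> 1" using that by simp
      then show ?thesis by linarith
    qed
    then show ?thesis unfolding B_def by (intro prod_pos) auto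
  qed
  have "2 / A \<le> 1 / B"
    using prod_ratio_ge_2[OF assms] A B unfolding A_def[symmetric] B_def[symmetric]
    by (simp add: field_simps)
  \<comment> \<open>The two weights have opposite signs, so their absolute values add up.\<close>
  moreover have "\<bar>node_weight d 0 - node_weight d 1\<bar> = 1 / A + 1 / B"
  proof -
    have "1 / A > 0" "1 / B > 0" using A B by simp_all
    then have "\<bar>- (1 / A) - 1 / B\<bar> = 1 / A + 1 / B" "\<bar>1 / A + 1 / B\<bar> = 1 / A + 1 / B" by linarith+
    then show ?thesis
      unfolding node_weight_0 node_weight_1 A_def[symmetric] B_def[symmetric]
      by (cases "even d") simp_all
  qed
  moreover have "(\<Sum>m=1..d. \<bar>node_weight d (2 * m\<^sup>2)\<bar>) \<le> (\<Sum>m=1..d. 2 / (2 * (real m)\<^sup>2 - 1) / A)"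
    unfolding A_def by (intro sum_mono abs_node_weight_le) auto
  moreover have "\<dots> = (\<Sum>m=1..d. 2 / (2 * (real m)\<^sup>2 - 1)) / A"
    by (simp add: sum_divide_distrib)
  moreover have "\<dots> \<le> 11 / 4 / A"
  proof -
    have "0 \<le> 1 / (2 * real d)" "0 \<le> 1 / (2 * (real d + 1))" by auto
    with sum_two_over_le[OF assms] have "(\<Sum>m=1..d. 2 / (2 * (real m)\<^sup>2 - 1)) \<le> 11 / 4" by linarith
    then show ?thesis using A by (intro divide_right_mono) auto
  qed
  moreover have "11 / 4 / A < 3 / A" "3 / A = 1 / A + 2 / A" using A by (simp_all add: field_simps)
  ultimately show ?thesis by linarith
qed

text \<open>After centring \<open>p\<close> at 1/2, the nodes 0 and 1 contribute half of the right
  side of \<open>node_weight_dominance\<close> in absolute value, and all others together at most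
  half of the left side.\<close>

lemma node_not_alternating:
  fixes p :: "nat \<Rightarrow> real"
  assumes "1 \<le> d" "\<And>x. x \<in> nodes d \<Longrightarrow> p x \<in> {0..1}" "\<bar>p 0 - p 1\<bar> = 1"
  shows "(\<Sum>x\<in>nodes d. node_weight d x * p x) \<noteq> 0"
proof
  assume zero: "(\<Sum>x\<in>nodes d. node_weight d x * p x) = 0"
  \<comment> \<open>The weights annihilate constants, so the centring does not change the
    sum.\<close>
  have "(\<Sum>x\<in>nodes d. node_weight d x * poly [:1/2:] (real x)) = 0"
    by (rule sum_node_weight_poly) simp
  with zero have "(\<Sum>x\<in>nodes d. node_weight d x * (p x - 1/2)) = 0"
    by (simp add: right_diff_distrib sum_subtractf)
  moreover have "(\<Sum>x\<in>nodes d. node_weight d x * (p x - 1/2))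
      = node_weight d 0 * (p 0 - 1/2) + node_weight d 1 * (p 1 - 1/2)
        + (\<Sum>m=1..d. node_weight d (2 * m\<^sup>2) * (p (2 * m\<^sup>2) - 1/2))"
    unfolding nodes_def using nodes_new[of d] by (simp add: sum.reindex inj_nodes)
  moreover have "p 0 \<in> {0..1}" "p 1 \<in> {0..1}"
    using assms(2)[of 0] assms(2)[of 1] by (simp_all add: nodes_def)
  then have "p 0 = 0 \<and> p 1 = 1 \<or> p 0 = 1 \<and> p 1 = 0" using assms(3) by auto
  then have "\<bar>node_weight d 0 * (p 0 - 1/2) + node_weight d 1 * (p 1 - 1/2)\<bar>
      = \<bar>node_weight d 0 - node_weight d 1\<bar> / 2"
    by (elim disjE conjE) (simp_all only:, simp_all add: abs_if)
  moreover have "\<bar>\<Sum>m=1..d. node_weight d (2 * m\<^sup>2) * (p (2 * m\<^sup>2) - 1/2)\<bar>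
      \<le> (\<Sum>m=1..d. \<bar>node_weight d (2 * m\<^sup>2)\<bar> * (1/2))"
  proof (intro order.trans[OF sum_abs] sum_mono)
    fix m assume "m \<in> {1..d}"
    then have "p (2 * m\<^sup>2) \<in> {0..1}" by (intro assms(2)) (auto simp: nodes_def)
    then have "\<bar>p (2 * m\<^sup>2) - 1/2\<bar> \<le> 1/2" unfolding atLeastAtMost_iff by linarith
    then show "\<bar>node_weight d (2 * m\<^sup>2) * (p (2 * m\<^sup>2) - 1/2)\<bar> \<le> \<bar>node_weight d (2 * m\<^sup>2)\<bar> * (1/2)"
      unfolding abs_mult by (intro mult_left_mono) auto
  qed
  moreover have "\<dots> < \<bar>node_weight d 0 - node_weight d 1\<bar> / 2"
    unfolding sum_distrib_right[symmetric] using node_weight_dominance[OF assms(1)] by simp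
  ultimately show False by linarith
qed

section \<open>Supports of monomials and restrictions\<close>

definition mono_supp :: "nat \<Rightarrow> (nat \<Rightarrow> nat) \<Rightarrow> nat set" where
  "mono_supp n u = {i. i < n \<and> u i \<noteq> 0}"

definition supports :: "nat \<Rightarrow> nat \<Rightarrow> ((nat \<Rightarrow> nat) \<Rightarrow> real) \<Rightarrow> nat set set" where
  "supports n q f = mono_supp n ` {u \<in> grid n q. coeffs n q f u \<noteq> 0}"

lemma finite_supports [simp]: "finite (supports n q f)"
  by (simp add: supports_def)

lemma supports_subset: "S \<in> supports n q f \<Longrightarrow> S \<subseteq> {..<n}"
  by (auto simp: supports_def mono_supp_def)

lemma card_supports_le: "S \<in> supports n q f \<Longrightarrow> card S \<le> deg n q f"
  unfolding deg_def supports_def weight_def mono_supp_def by (intro Max_ge) auto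

lemma fun_expansion:
  "x \<in> grid n q \<Longrightarrow> f x = (\<Sum>u\<in>grid n q. coeffs n q f u * monomial n u x)"
  using represents_coeffs by (simp add: represents_def)

lemma grid_upd: "u \<in> grid n q \<Longrightarrow> j < n \<Longrightarrow> k < q \<Longrightarrow> u(j := k) \<in> grid n q"
  unfolding grid_def by (auto simp: PiE_iff extensional_def)

lemma grid_less: "u \<in> grid n q \<Longrightarrow> i < n \<Longrightarrow> u i < q"
  unfolding grid_def by auto

lemma relevant_imp_support:
  assumes "relevant n q f i" "i < n"
  shows "\<exists>S\<in>supports n q f. i \<in> S"
proof (rule ccontr)
  assume neg: "\<not> ?thesis"
  obtain x y where xy: "x \<in> grid n q" "y \<in> grid n q" "\<forall>j<n. j \<noteq> i \<longrightarrow> x j = y j" "f x \<noteq> f y"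
    using assms(1) unfolding relevant_def by blast
  have eq: "coeffs n q f u * monomial n u x = coeffs n q f u * monomial n u y" if "u \<in> grid n q" for u
  proof (cases "coeffs n q f u = 0")
    case False
    then have "u i = 0" using neg that assms(2) by (auto simp: supports_def mono_supp_def)
    then have "monomial n u x = monomial n u y"
      unfolding monomial_def using xy(3) by (intro prod.cong) (simp, metis lessThan_iff power_0)
    then show ?thesis by simp
  qed simp
  have "f x = (\<Sum>u\<in>grid n q. coeffs n q f u * monomial n u x)"
    by (rule fun_expansion[OF xy(1)])
  also have "\<dots> = (\<Sum>u\<in>grid n q. coeffs n q f u * monomial n u y)"
    by (intro sum.cong refl eq)
  also have "\<dots> = f y"
    by (rule fun_expansion[OF xy(2), symmetric])
  finally show False using xy(4) by contradiction
qed

text \<open>By uniqueness of the representation, a constant function has at most the constant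
  monomial, whose exponent vector is \<open>o0\<close>.\<close>

lemma nonempty_support_imp_nonconstant:
  assumes "S \<in> supports n q f" "S \<noteq> {}" "x \<in> grid n q"
  shows "\<exists>y\<in>grid n q. f y \<noteq> f x"
proof (rule ccontr)
  assume "\<not> ?thesis"
  then have const: "f y = f x" if "y \<in> grid n q" for y using that by blast
  obtain u where u: "u \<in> grid n q" "coeffs n q f u \<noteq> 0" "S = mono_supp n u"
    using assms(1) by (auto simp: supports_def)
  obtain i where i: "i < n" "u i \<noteq> 0" using assms(2) u by (auto simp: mono_supp_def)
  define o0 where "o0 = (\<lambda>i\<in>{..<n}. 0::nat)"
  have q: "q > 0" using grid_less[OF assms(3) i(1)] by simp
  then have o: "o0 \<in> grid n q" by (auto simp: o0_def grid_def)
  have "represents n q (\<lambda>u. if u = o0 then f x else 0) f"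
    unfolding represents_def
  proof (intro conjI allI impI ballI)
    fix y assume y: "y \<in> grid n q"
    have "monomial n o0 y = 1" by (auto simp: monomial_def o0_def)
    then have "(\<Sum>u\<in>grid n q. (if u = o0 then f x else 0) * monomial n u y) = f x"
      using o by (subst sum.remove[of _ o0]) auto
    then show "f y = (\<Sum>u\<in>grid n q. (if u = o0 then f x else 0) * monomial n u y)"
      using const[OF y] by simp
  qed (use o in auto)
  then have "coeffs n q f = (\<lambda>u. if u = o0 then f x else 0)" by (rule coeffs_eqI)
  with u have "u = o0" by (auto split: if_splits)
  with i show False by (simp add: o0_def)
qed

section \<open>Restrictions and their effect on coefficients and supports\<close>

text \<open>A restriction keeps the number \<open>n\<close> of variables; the fixed ones become irrelevant.\<close>

definition restr :: "nat set \<Rightarrow> (nat \<Rightarrow> nat) \<Rightarrow> ((nat \<Rightarrow> nat) \<Rightarrow> real) \<Rightarrow> (nat \<Rightarrow> nat) \<Rightarrow> real" where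
  "restr H a f = (\<lambda>x. f (override_on x a H))"

lemma restr_empty [simp]: "restr {} a f = f"
  by (simp add: restr_def)

lemma restr_insert: "restr (insert j H) a f = restr H a (restr {j} a f)"
proof -
  have "override_on x a (insert j H) = override_on (override_on x a H) a {j}" for x
    by (auto simp: override_on_def)
  then show ?thesis by (simp add: restr_def)
qed

lemma override_on_grid: "x \<in> grid n q \<Longrightarrow> a \<in> grid n q \<Longrightarrow> override_on x a H \<in> grid n q"
  by (auto simp: grid_def PiE_iff override_on_def extensional_def)

lemma boolean_restr: "boolean_fun n q f \<Longrightarrow> a \<in> grid n q \<Longrightarrow> boolean_fun n q (restr H a f)"
  by (auto simp: boolean_fun_def restr_def override_on_grid)

lemma sum_grid_split:
  assumes "j < n"
  shows "(\<Sum>u\<in>grid n q. h u) = (\<Sum>v | v \<in> grid n q \<and> v j = 0. \<Sum>k<q. h (v(j := k)))"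
proof -
  have "(\<Sum>v | v \<in> grid n q \<and> v j = 0. \<Sum>k<q. h (v(j := k)))
      = (\<Sum>(v, k)\<in>{v \<in> grid n q. v j = 0} \<times> {..<q}. h (v(j := k)))"
    by (simp add: sum.cartesian_product)
  also have "\<dots> = (\<Sum>u\<in>grid n q. h u)"
    by (rule sum.reindex_bij_witness[where i = "\<lambda>u. (u(j := 0), u j)" and j = "\<lambda>(v, k). v(j := k)"])
       (use assms in \<open>auto simp: grid_upd grid_less intro!: grid_upd dest: grid_less[of _ n q j]\<close>)
  finally show ?thesis ..
qed

text \<open>Fixing the variable \<open>j\<close> merges the monomials that differ only in the
  exponent of this variable.\<close>

lemma coeffs_restr1:
  assumes "j < n" "a j < q"
  shows "coeffs n q (restr {j} a f) =
    (\<lambda>u. if u \<in> grid n q \<and> u j = 0 then \<Sum>k<q. coeffs n q f (u(j := k)) * real (a j) ^ k else 0)"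
    (is "_ = ?\<beta>")
proof (rule coeffs_eqI, unfold represents_def, intro conjI allI impI ballI)
  fix x assume x: "x \<in> grid n q"
  let ?\<alpha> = "coeffs n q f"
  have ov: "override_on x a {j} = x(j := a j)" by (auto simp: override_on_def)
  have mono: "monomial n (v(j := k)) (x(j := a j)) = real (a j) ^ k * monomial n v x"
    if "v j = 0" for v k
  proof -
    have "(\<Prod>i\<in>{..<n} - {j}. real ((x(j := a j)) i) ^ (v(j := k)) i) = (\<Prod>i\<in>{..<n} - {j}. real (x i) ^ v i)"
      by (intro prod.cong) auto
    then show ?thesis
      using assms(1) that by (simp add: monomial_def prod.remove[of "{..<n}" j])
  qed
  have "restr {j} a f x = (\<Sum>u\<in>grid n q. ?\<alpha> u * monomial n u (x(j := a j)))"
    unfolding restr_def ov using fun_expansion[OF grid_upd[OF x assms]] .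
  also have "\<dots> = (\<Sum>v | v \<in> grid n q \<and> v j = 0. \<Sum>k<q. ?\<alpha> (v(j := k)) * (real (a j) ^ k * monomial n v x))"
    unfolding sum_grid_split[OF assms(1)] by (intro sum.cong) (auto simp: mono)
  also have "\<dots> = (\<Sum>v | v \<in> grid n q \<and> v j = 0. ?\<beta> v * monomial n v x)"
    by (intro sum.cong) (auto simp: sum_distrib_right mult.assoc)
  also have "\<dots> = (\<Sum>v\<in>grid n q. ?\<beta> v * monomial n v x)"
    by (intro sum.mono_neutral_left) auto
  finally show "restr {j} a f x = (\<Sum>v\<in>grid n q. ?\<beta> v * monomial n v x)" .
qed auto

lemma supports_restr1:
  assumes "j < n" "a j < q" "S \<in> supports n q (restr {j} a f)"
  shows "\<exists>T\<in>supports n q f. S = T - {j}"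
proof -
  obtain u where u: "u \<in> grid n q" "u j = 0" "S = mono_supp n u"
      "(\<Sum>k<q. coeffs n q f (u(j := k)) * real (a j) ^ k) \<noteq> 0"
    using assms(3) unfolding supports_def coeffs_restr1[where a = a, OF assms(1,2)]
    by (auto split: if_splits)
  then obtain k where k: "k < q" "coeffs n q f (u(j := k)) \<noteq> 0"
    by (metis (no_types, lifting) lessThan_iff mult_zero_left sum.neutral)
  have "S = mono_supp n (u(j := k)) - {j}" using u by (auto simp: mono_supp_def)
  moreover have "mono_supp n (u(j := k)) \<in> supports n q f"
    using k u assms(1) by (auto simp: supports_def intro!: imageI grid_upd)
  ultimately show ?thesis by blast
qed

lemma supports_restr:
  assumes "finite H" "H \<subseteq> {..<n}" "a \<in> grid n q" "S \<in> supports n q (restr H a f)"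
  shows "\<exists>T\<in>supports n q f. S = T - H"
  using assms
proof (induction H arbitrary: f S)
  case (insert j H)
  from insert.prems have "S \<in> supports n q (restr H a (restr {j} a f))"
    by (simp only: restr_insert[of j H])
  then obtain T where T: "T \<in> supports n q (restr {j} a f)" "S = T - H"
    using insert.IH[of S "restr {j} a f"] insert.prems by auto
  then obtain U where "U \<in> supports n q f" "T = U - {j}"
    using supports_restr1[of j n a q T f] insert.prems grid_less by auto
  with T show ?case by (intro bexI[of _ U]) auto
qed auto

text \<open>A monomial with support \<open>M\<close> could only be cancelled by monomials with
  support \<open>insert j M\<close>, and these are excluded by maximality. Restriction only removes
  elements from supports, so \<open>M\<close> stays maximal and the induction continues.\<close>

lemma maximal_support_restr:
  assumes "finite H" "H \<subseteq> {..<n}" "a \<in> grid n q" "M \<in> supports n q f" "M \<inter> H = {}"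
    and "\<And>T. T \<in> supports n q f \<Longrightarrow> \<not> M \<subset> T"
  shows "M \<in> supports n q (restr H a f)"
  using assms
proof (induction H arbitrary: f)
  case (insert j H)
  let ?g = "restr {j} a f"
  have j: "j < n" "a j < q" "j \<notin> M" using insert.prems grid_less by auto
  obtain u where u: "u \<in> grid n q" "coeffs n q f u \<noteq> 0" "M = mono_supp n u"
    using insert.prems(3) by (auto simp: supports_def)
  have uj: "u j = 0" using j u by (auto simp: mono_supp_def)
  have zero: "coeffs n q f (u(j := k)) = 0" if "k < q" "k \<noteq> 0" for k
  proof (rule ccontr)
    assume "coeffs n q f (u(j := k)) \<noteq> 0"
    then have "mono_supp n (u(j := k)) \<in> supports n q f"
      using that u j by (auto simp: supports_def intro!: imageI grid_upd)
    moreover have "mono_supp n (u(j := k)) = insert j M"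
      using that u j by (auto simp: mono_supp_def)
    ultimately show False using insert.prems(5) j(3) by blast
  qed
  have "coeffs n q ?g u = (\<Sum>k<q. coeffs n q f (u(j := k)) * real (a j) ^ k)"
    using u(1) uj by (simp add: coeffs_restr1[where a = a, OF j(1,2)])
  also have "\<dots> = coeffs n q f (u(j := 0))"
    using j(2) zero by (subst sum.remove[of _ 0]) auto
  also have "u(j := 0) = u" using uj by auto
  finally have "coeffs n q ?g u \<noteq> 0" using u(2) by simp
  then have "M \<in> supports n q ?g" using u by (auto simp: supports_def)
  moreover have "\<not> M \<subset> T" if T: "T \<in> supports n q ?g" for T
  proof
    assume "M \<subset> T"
    moreover obtain U where "U \<in> supports n q f" "T = U - {j}"
      using supports_restr1[OF j(1,2) T] by blast
    ultimately show False using insert.prems(5)[of U] by blast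
  qed
  ultimately have "M \<in> supports n q (restr H a ?g)"
    using insert.prems by (intro insert.IH) auto
  then show ?case by (simp only: restr_insert[of j H])
qed auto

text \<open>Fixing all variables outside \<open>M\<close> as in \<open>x\<close> keeps the support
  \<open>M\<close>, so the restricted function is not constant.\<close>

lemma sensitive_maximal_support:
  assumes "x \<in> grid n q" "M \<in> supports n q f" "M \<noteq> {}"
    and "\<And>T. T \<in> supports n q f \<Longrightarrow> \<not> M \<subset> T"
  shows "\<exists>y\<in>grid n q. f (override_on x y M) \<noteq> f x"
proof -
  let ?H = "{..<n} - M"
  have "M \<in> supports n q (restr ?H x f)"
    using assms by (intro maximal_support_restr) auto
  then obtain y where y: "y \<in> grid n q" "restr ?H x f y \<noteq> restr ?H x f x"
    using nonempty_support_imp_nonconstant assms(1,3) by blast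
  have "override_on y x ?H = override_on x y M"
    using y(1) assms(1) supports_subset[OF assms(2)]
    by (auto simp: override_on_def grid_def PiE_iff extensional_def fun_eq_iff)
  moreover have "override_on x x ?H = x" by (auto simp: override_on_def)
  ultimately show ?thesis using y by (auto simp: restr_def)
qed

section \<open>Weights of variables\<close>

text \<open>Meaningful only if some support contains \<open>i\<close>, since otherwise the maximum
  is over the empty set; \<open>var_weight\<close> tests this first.\<close>

definition var_deg :: "nat \<Rightarrow> nat \<Rightarrow> ((nat \<Rightarrow> nat) \<Rightarrow> real) \<Rightarrow> nat \<Rightarrow> nat" where
  "var_deg n q f i = Max (card ` {S \<in> supports n q f. i \<in> S})"

definition var_weight :: "nat \<Rightarrow> nat \<Rightarrow> ((nat \<Rightarrow> nat) \<Rightarrow> real) \<Rightarrow> nat \<Rightarrow> real" where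
  "var_weight n q f i = (if \<exists>S\<in>supports n q f. i \<in> S then 1 / real q ^ var_deg n q f i else 0)"

lemma var_weight_nonneg: "var_weight n q f i \<ge> 0"
  by (simp add: var_weight_def)

lemma var_deg_ge: "S \<in> supports n q f \<Longrightarrow> i \<in> S \<Longrightarrow> card S \<le> var_deg n q f i"
  unfolding var_deg_def by (intro Max_ge) auto

lemma var_deg_attained:
  assumes "S \<in> supports n q f" "i \<in> S"
  shows "\<exists>T\<in>supports n q f. i \<in> T \<and> card T = var_deg n q f i"
proof -
  have "var_deg n q f i \<in> card ` {S \<in> supports n q f. i \<in> S}"
    unfolding var_deg_def using assms by (intro Max_in) auto
  then show ?thesis by auto
qed

section \<open>Weights under fixing a variable\<close>

lemma support_survives_restr1:
  assumes "i \<noteq> j" "j < n" "S \<in> supports n q f" "i \<in> S"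
  shows "\<exists>b<q. \<exists>T\<in>supports n q (restr {j} (a(j := b)) f). i \<in> T"
proof (rule ccontr)
  assume neg: "\<not> ?thesis"
  obtain u where u: "u \<in> grid n q" "coeffs n q f u \<noteq> 0" "S = mono_supp n u"
    using assms(3) by (auto simp: supports_def)
  have q: "u j < q" using grid_less[OF u(1) assms(2)] .
  define v where "v = u(j := 0)"
  \<comment> \<open>The value of \<open>p\<close> at \<open>b\<close> is the coefficient of
    \<open>v\<close> after setting the variable \<open>j\<close> to \<open>b\<close>. If
    \<open>i\<close> never survived, \<open>p\<close> would have \<open>q\<close> zeros but degree
    below \<open>q\<close>.\<close>
  define p where "p = (\<Sum>k<q. monom (coeffs n q f (v(j := k))) k)"
  have v: "v \<in> grid n q" "v j = 0" "i \<in> mono_supp n v"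
    using u assms q by (auto simp: v_def mono_supp_def intro!: grid_upd)
  have deg: "degree p < q"
    using q unfolding p_def
    by (intro le_less_trans[OF degree_sum_le[of "{..<q}" _ "q - 1"]])
       (auto intro!: order.trans[OF degree_monom_le])
  have "p = 0"
  proof (rule poly_eqI_degree[where A = "real ` {..<q}"])
    fix x assume "x \<in> real ` {..<q}"
    then obtain b where b: "b < q" "x = real b" by auto
    have "mono_supp n v \<notin> supports n q (restr {j} (a(j := b)) f)"
      using neg b(1) v(3) by blast
    then have "coeffs n q (restr {j} (a(j := b)) f) v = 0"
      using v(1) by (auto simp: supports_def)
    then show "poly p x = poly 0 x"
      using b assms(2) v by (simp add: coeffs_restr1 p_def poly_sum poly_monom)
  qed (use deg q in \<open>simp_all add: card_image\<close>)
  then have "coeff p (u j) = 0" by simp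
  then have "coeffs n q f (v(j := u j)) = 0"
    using q by (simp add: p_def coeff_sum sum.remove[of "{..<q}" "u j"])
  with u(2) show False by (simp add: v_def)
qed

text \<open>
  If the variable \<open>i\<close> disappears for the value \<open>c\<close> of the variable \<open>j\<close>, then for the other values
  its degree drops; the factor \<open>q\<close> gained this way pays for the values where its weight is lost.
\<close>

lemma support_insert_if_vanishes:
  assumes "j < n" "b < q" "c < q"
    and "T \<in> supports n q (restr {j} (a(j := b)) f)" "i \<in> T"
    and "\<And>S. S \<in> supports n q (restr {j} (a(j := c)) f) \<Longrightarrow> i \<notin> S"
  shows "j \<notin> T \<and> insert j T \<in> supports n q f"
proof -
  let ?\<alpha> = "coeffs n q f"
  let ?g = "\<lambda>b. restr {j} (a(j := b)) f"
  obtain v where v: "v \<in> grid n q" "coeffs n q (?g b) v \<noteq> 0" "T = mono_supp n v"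
    using assms(4) by (auto simp: supports_def)
  have vj: "v j = 0" using v(2) assms(1,2) by (simp add: coeffs_restr1 split: if_splits)
  have "mono_supp n v \<notin> supports n q (?g c)" using assms(5,6) v(3) by blast
  then have "coeffs n q (?g c) v = 0" using v(1) by (auto simp: supports_def)
  then have ne: "(\<Sum>k<q. ?\<alpha> (v(j := k)) * real b ^ k) \<noteq> (\<Sum>k<q. ?\<alpha> (v(j := k)) * real c ^ k)"
    using v(1,2) vj assms(1-3) by (simp add: coeffs_restr1)
  \<comment> \<open>The term with \<open>k = 0\<close> is the same for \<open>b\<close> and
    \<open>c\<close>, so the difference comes from a monomial containing the variable
    \<open>j\<close>.\<close>
  obtain k where k: "k < q" "k \<noteq> 0" "?\<alpha> (v(j := k)) \<noteq> 0"
  proof (rule ccontr)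
    assume "\<not> thesis"
    then have z: "k < q \<Longrightarrow> k \<noteq> 0 \<Longrightarrow> ?\<alpha> (v(j := k)) = 0" for k using that by blast
    have "?\<alpha> (v(j := k)) * real b ^ k = ?\<alpha> (v(j := k)) * real c ^ k" if "k < q" for k
      using z[OF that] by (cases "k = 0") auto
    with ne show False by simp
  qed
  have "mono_supp n (v(j := k)) \<in> supports n q f"
    using k v assms(1) by (auto simp: supports_def intro!: imageI grid_upd)
  moreover have "mono_supp n (v(j := k)) = insert j T"
    using k(2) v(3) assms(1) by (auto simp: mono_supp_def)
  moreover have "j \<notin> T" using v(3) vj by (simp add: mono_supp_def)
  ultimately show ?thesis by simp
qed

text \<open>If \<open>i\<close> survives for every \<open>b\<close>, its degree never grows and each
  summand is at least the old weight. If it vanishes for some \<open>c\<close>, a single surviving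
  value has a degree smaller by at least one, and its weight alone is at least \<open>q\<close>
  times the old one.\<close>

lemma var_weight_restr1:
  assumes "i \<noteq> j" "j < n" "q > 0"
  shows "real q * var_weight n q f i \<le> (\<Sum>b<q. var_weight n q (restr {j} (a(j := b)) f) i)"
proof (cases "\<exists>S\<in>supports n q f. i \<in> S")
  case False
  then have "var_weight n q f i = 0" by (simp add: var_weight_def)
  then show ?thesis by (simp add: sum_nonneg var_weight_nonneg)
next
  case True
  let ?g = "\<lambda>b. restr {j} (a(j := b)) f"
  let ?D = "var_deg n q f i"
  have w: "var_weight n q f i = 1 / real q ^ ?D" using True by (simp add: var_weight_def)
  show ?thesis
  proof (cases "\<forall>b<q. \<exists>S\<in>supports n q (?g b). i \<in> S")
    case all: True
    have "1 / real q ^ ?D \<le> var_weight n q (?g b) i" if b: "b < q" for b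
    proof -
      obtain S where S: "S \<in> supports n q (?g b)" "i \<in> S" using all b by blast
      obtain T where T: "T \<in> supports n q (?g b)" "i \<in> T" "card T = var_deg n q (?g b) i"
        using var_deg_attained[OF S] by blast
      obtain U where U: "U \<in> supports n q f" "T = U - {j}"
        using supports_restr1[OF assms(2) _ T(1)] b by auto
      have "card T \<le> card U"
        using U supports_subset[OF U(1)] by (intro card_mono) (auto intro: finite_subset)
      also have "card U \<le> ?D" using U T by (intro var_deg_ge) auto
      finally have "real q ^ var_deg n q (?g b) i \<le> real q ^ ?D"
        using assms(3) T(3) by (intro power_increasing) auto
      then show ?thesis
        using S assms(3) unfolding var_weight_def by (auto intro!: divide_left_mono)
    qed
    then have "(\<Sum>b<q. 1 / real q ^ ?D) \<le> (\<Sum>b<q. var_weight n q (?g b) i)"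
      by (intro sum_mono) auto
    then show ?thesis by (simp add: w)
  next
    case False
    then obtain c where c: "c < q" "\<And>S. S \<in> supports n q (?g c) \<Longrightarrow> i \<notin> S" by blast
    obtain b S where b: "b < q" and S: "S \<in> supports n q (?g b)" "i \<in> S"
      using True support_survives_restr1[OF assms(1,2), of _ q f a] by blast
    obtain T where T: "T \<in> supports n q (?g b)" "i \<in> T" "card T = var_deg n q (?g b) i"
      using var_deg_attained[OF S] by blast
    have ins: "j \<notin> T" "insert j T \<in> supports n q f"
      using support_insert_if_vanishes[OF assms(2) b c(1) T(1,2) c(2)] by auto
    have "finite T" using supports_subset[OF T(1)] finite_subset by blast
    then have "Suc (card T) = card (insert j T)" using ins by simp
    also have "\<dots> \<le> ?D" using ins T by (intro var_deg_ge) auto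
    finally have "real q ^ Suc (var_deg n q (?g b) i) \<le> real q ^ ?D"
      unfolding T(3) using assms(3) by (intro power_increasing) auto
    then have "real q * (1 / real q ^ ?D) \<le> 1 / real q ^ var_deg n q (?g b) i"
      using assms(3) by (simp add: divide_simps mult.commute)
    also have "\<dots> = var_weight n q (?g b) i" using S by (auto simp: var_weight_def)
    also have "\<dots> \<le> (\<Sum>b<q. var_weight n q (?g b) i)"
      using b by (intro member_le_sum) (auto simp: var_weight_nonneg)
    finally show ?thesis by (simp add: w)
  qed
qed

text \<open>Averaging over the values of the variables in \<open>H\<close>, one at a time, shows
  that a bound valid for all restrictions holds for \<open>f\<close>. The set \<open>I\<close>
  avoids \<open>H\<close> because fixed variables lose their weight.\<close>

lemma sum_var_weight_restr_le:
  assumes "finite H" "H \<subseteq> {..<n}" "I \<inter> H = {}" "q > 0"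
    and "\<And>a. a \<in> grid n q \<Longrightarrow> (\<Sum>i\<in>I. var_weight n q (restr H a f) i) \<le> C"
  shows "(\<Sum>i\<in>I. var_weight n q f i) \<le> C"
  using assms
proof (induction H arbitrary: f)
  case empty
  have "(\<lambda>i\<in>{..<n}. 0) \<in> grid n q" using \<open>q > 0\<close> by (auto simp: grid_def)
  with empty show ?case by fastforce
next
  case (insert j H)
  have j: "j < n" using insert.prems by simp
  \<comment> \<open>An arbitrary base point: only its entry at \<open>j\<close>, overwritten by
    \<open>b\<close>, has an effect.\<close>
  define o0 where "o0 = (\<lambda>i\<in>{..<n}. 0::nat)"
  let ?g = "\<lambda>b. restr {j} (o0(j := b)) f"
  have "(\<Sum>i\<in>I. var_weight n q (?g b) i) \<le> C" if b: "b < q" for b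
  proof (rule insert.IH)
    fix a assume a: "a \<in> grid n q"
    have "restr H a (?g b) = restr (insert j H) (a(j := b)) f"
    proof -
      have "override_on (override_on x a H) (o0(j := b)) {j} = override_on x (a(j := b)) (insert j H)" for x
        using insert.hyps by (auto simp: override_on_def)
      then show ?thesis by (simp add: restr_def)
    qed
    then show "(\<Sum>i\<in>I. var_weight n q (restr H a (?g b)) i) \<le> C"
      using insert.prems(4)[OF grid_upd[OF a j b]] by (simp only:)
  qed (use insert.prems in auto)
  then have "(\<Sum>b<q. \<Sum>i\<in>I. var_weight n q (?g b) i) \<le> (\<Sum>b<q. C)"
    by (intro sum_mono) auto
  moreover have "real q * (\<Sum>i\<in>I. var_weight n q f i) \<le> (\<Sum>i\<in>I. \<Sum>b<q. var_weight n q (?g b) i)"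
    unfolding sum_distrib_left using insert.prems j
    by (intro sum_mono var_weight_restr1) auto
  ultimately have "real q * (\<Sum>i\<in>I. var_weight n q f i) \<le> real q * C"
    by (subst (asm) sum.swap) simp
  then show ?case using \<open>q > 0\<close> by simp
qed

lemma num_relevant_le:
  assumes "q > 0" "\<And>S. S \<in> supports n q f \<Longrightarrow> card S \<le> d"
  shows "real (num_relevant n q f) \<le> real q ^ d * (\<Sum>i<n. var_weight n q f i)"
proof -
  let ?R = "{i. i < n \<and> relevant n q f i}"
  have "1 / real q ^ d \<le> var_weight n q f i" if i: "i \<in> ?R" for i
  proof -
    obtain S where S: "S \<in> supports n q f" "i \<in> S" using relevant_imp_support i by blast
    obtain T where T: "T \<in> supports n q f" "card T = var_deg n q f i"
      using var_deg_attained[OF S] by blast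
    have "real q ^ var_deg n q f i \<le> real q ^ d"
      using assms(2)[OF T(1)] T(2) assms(1) by (intro power_increasing) auto
    then show ?thesis
      using S assms(1) unfolding var_weight_def by (auto intro!: divide_left_mono)
  qed
  then have "(\<Sum>i\<in>?R. 1 / real q ^ d) \<le> (\<Sum>i\<in>?R. var_weight n q f i)" by (intro sum_mono)
  also have "\<dots> \<le> (\<Sum>i<n. var_weight n q f i)"
    by (intro sum_mono2) (auto simp: var_weight_nonneg)
  finally show ?thesis
    using assms(1) by (simp add: num_relevant_def divide_simps mult.commute)
qed

section \<open>Disjoint sensitive blocks\<close>

text \<open>Stated without division: for j at most \<open>card K\<close>, a random j-subset of
  \<open>K\<close> contains \<open>S\<close> with probability C(j, s) / C(card K, s), where s is the
  size of \<open>S\<close>. Outside the range from s to \<open>card K\<close> both sides are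
  0.\<close>

lemma choose_inclusion_sum:
  fixes K :: "'a set"
  assumes "finite K" "S \<subseteq> K"
  shows "card {Z. Z \<subseteq> K \<and> card Z = j \<and> S \<subseteq> Z} * (card K choose card S)
       = (card K choose j) * (j choose card S)"
proof (cases "card S \<le> j")
  case False
  have "card S \<le> card Z" if "Z \<subseteq> K" "S \<subseteq> Z" for Z
    using that assms by (meson card_mono finite_subset)
  then have "{Z. Z \<subseteq> K \<and> card Z = j \<and> S \<subseteq> Z} = {}" using False by auto
  then have "card {Z. Z \<subseteq> K \<and> card Z = j \<and> S \<subseteq> Z} = 0" by (metis card.empty)
  then show ?thesis using False by simp
next
  case True
  have finS: "finite S" using assms finite_subset by blast
  have "bij_betw (\<lambda>Z. Z - S) {Z. Z \<subseteq> K \<and> card Z = j \<and> S \<subseteq> Z} {Y. Y \<subseteq> K - S \<and> card Y = j - card S}"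
  proof (rule bij_betwI[where g = "\<lambda>Y. Y \<union> S"])
    show "(\<lambda>Z. Z - S) \<in> {Z. Z \<subseteq> K \<and> card Z = j \<and> S \<subseteq> Z} \<rightarrow> {Y. Y \<subseteq> K - S \<and> card Y = j - card S}"
      using finS by (auto simp: card_Diff_subset)
    show "(\<lambda>Y. Y \<union> S) \<in> {Y. Y \<subseteq> K - S \<and> card Y = j - card S} \<rightarrow> {Z. Z \<subseteq> K \<and> card Z = j \<and> S \<subseteq> Z}"
    proof clarify
      fix Y assume Y: "Y \<subseteq> K - S" "card Y = j - card S"
      then have "finite Y" "Y \<inter> S = {}" using assms by (auto intro: finite_subset[of Y K])
      then show "Y \<union> S \<subseteq> K \<and> card (Y \<union> S) = j \<and> S \<subseteq> Y \<union> S"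
        using Y True assms finS by (auto simp: card_Un_disjoint)
    qed
  qed auto
  then have "card {Z. Z \<subseteq> K \<and> card Z = j \<and> S \<subseteq> Z} = card {Y. Y \<subseteq> K - S \<and> card Y = j - card S}"
    by (rule bij_betw_same_card)
  also have "\<dots> = (card K - card S) choose (j - card S)"
    using assms finS by (simp add: n_subsets card_Diff_subset)
  finally have eq: "card {Z. Z \<subseteq> K \<and> card Z = j \<and> S \<subseteq> Z} = (card K - card S) choose (j - card S)" .
  show ?thesis
  proof (cases "j \<le> card K")
    case True
    then show ?thesis
      using choose_mult[OF \<open>card S \<le> j\<close> True] by (simp add: eq mult.commute)
  next
    case False
    then have "card K - card S < j - card S" using \<open>card S \<le> j\<close> card_mono[OF assms] by linarith
    then show ?thesis using False by (simp add: eq binomial_eq_0)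
  qed
qed

lemma binomial_poly_ex:
  "\<exists>p :: real poly. degree p \<le> s \<and> (\<forall>j. poly p (real j) = real (j choose s))"
proof -
  define p :: "real poly" where "p = smult (1 / fact s) (\<Prod>i<s. [:- real i, 1:])"
  have "degree p \<le> s"
    unfolding p_def
    using degree_prod_sum_le[of "{..<s}" "\<lambda>i. [:- real i, 1:]"]
    by (intro order.trans[OF degree_smult_le]) (simp add: o_def)
  moreover have "poly p (real j) = real (j choose s)" for j
    unfolding binomial_gbinomial gbinomial_prod_rev
    by (simp add: p_def poly_prod atLeast0LessThan)
  ultimately show ?thesis by blast
qed

text \<open>The average of \<open>F\<close> over the sets of size j is a polynomial in j of degree
  at most \<open>d\<close>, by \<open>choose_inclusion_sum\<close>. Several indices \<open>t\<close>
  may share a set, so like terms need not be collected.\<close>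

lemma card_sensitive_less:
  fixes K :: "'a set" and F :: "'a set \<Rightarrow> real" and S :: "'b \<Rightarrow> 'a set"
  assumes K: "finite K" and d: "1 \<le> d"
    and S: "\<And>t. t \<in> I \<Longrightarrow> S t \<subseteq> K \<and> card (S t) \<le> d"
    and F: "\<And>Z. Z \<subseteq> K \<Longrightarrow> F Z = (\<Sum>t\<in>I. c t * of_bool (S t \<subseteq> Z))"
    and bool: "\<And>Z. Z \<subseteq> K \<Longrightarrow> F Z \<in> {0, 1}"
    and sens: "\<And>i. i \<in> K \<Longrightarrow> F {i} \<noteq> F {}"
  shows "card K < 2 * d\<^sup>2"
proof (rule ccontr)
  assume "\<not> card K < 2 * d\<^sup>2"
  then have k: "2 * d\<^sup>2 \<le> card K" by simp
  define L where "L = (\<lambda>j. {Z. Z \<subseteq> K \<and> card Z = j})"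
  define p where "p = (\<lambda>j. (\<Sum>Z\<in>L j. F Z) / real (card K choose j))"
  have finL: "finite (L j)" and cardL: "card (L j) = card K choose j" for j
    using K by (auto simp: L_def n_subsets)
  \<comment> \<open>Here the assumption 2 d^2 <= \<open>card K\<close> enters: sets of every size
    occurring as a node exist in \<open>K\<close>.\<close>
  have node_le: "x \<le> card K" if "x \<in> nodes d" for x
  proof -
    have "m\<^sup>2 \<le> d\<^sup>2" if "m \<le> d" for m using that by (intro power_mono) auto
    moreover have "1 \<le> d\<^sup>2" using d by simp
    ultimately have "x \<le> 2 * d\<^sup>2" using \<open>x \<in> nodes d\<close> by (fastforce simp: nodes_def)
    with k show ?thesis by simp
  qed
  have p_eq: "p j = (\<Sum>t\<in>I. c t / real (card K choose card (S t)) * real (j choose card (S t)))"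
    if j: "j \<le> card K" for j
  proof -
    have "(\<Sum>Z\<in>L j. F Z) = (\<Sum>Z\<in>L j. \<Sum>t\<in>I. c t * of_bool (S t \<subseteq> Z))"
      by (intro sum.cong) (auto simp: F L_def)
    also have "\<dots> = (\<Sum>t\<in>I. c t * (\<Sum>Z\<in>L j. of_bool (S t \<subseteq> Z)))"
      by (subst sum.swap) (simp add: sum_distrib_left)
    also have "\<dots> = (\<Sum>t\<in>I. real (card K choose j) *
        (c t / real (card K choose card (S t)) * real (j choose card (S t))))"
    proof (intro sum.cong refl)
      fix t assume t: "t \<in> I"
      let ?b = "real (card K choose card (S t))"
      have "?b \<noteq> 0" using S[OF t] card_mono[OF K, of "S t"] by auto
      have "(\<Sum>Z\<in>L j. of_bool (S t \<subseteq> Z)) = real (card {Z. Z \<subseteq> K \<and> card Z = j \<and> S t \<subseteq> Z})"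
        using finL[of j] by (simp add: sum_of_bool_eq L_def Int_def conj_assoc)
      also have "\<dots> = real (card K choose j) * real (j choose card (S t)) / ?b"
        using choose_inclusion_sum[OF K, of "S t" j] S[OF t] \<open>?b \<noteq> 0\<close>
        by (simp add: eq_divide_eq flip: of_nat_mult)
      finally show "c t * (\<Sum>Z\<in>L j. of_bool (S t \<subseteq> Z))
          = real (card K choose j) * (c t / ?b * real (j choose card (S t)))" by simp
    qed
    also have "\<dots> = real (card K choose j) *
        (\<Sum>t\<in>I. c t / real (card K choose card (S t)) * real (j choose card (S t)))"
      by (simp only: sum_distrib_left)
    finally show ?thesis
      using j by (simp add: p_def)
  qed
  have "(\<Sum>j\<in>nodes d. node_weight d j * p j)
      = (\<Sum>j\<in>nodes d. \<Sum>t\<in>I. c t / real (card K choose card (S t)) * (node_weight d j * real (j choose card (S t))))"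
    by (intro sum.cong refl) (simp add: p_eq node_le sum_distrib_left mult_ac)
  also have "\<dots> = (\<Sum>t\<in>I. c t / real (card K choose card (S t)) * (\<Sum>j\<in>nodes d. node_weight d j * real (j choose card (S t))))"
    by (subst sum.swap) (simp add: sum_distrib_left)
  also have "\<dots> = 0"
  proof (intro sum.neutral ballI)
    fix t assume t: "t \<in> I"
    obtain P :: "real poly" where P: "degree P \<le> card (S t)" "\<And>j. poly P (real j) = real (j choose card (S t))"
      using binomial_poly_ex by blast
    have "(\<Sum>j\<in>nodes d. node_weight d j * poly P (real j)) = 0"
      using P(1) S[OF t] by (intro sum_node_weight_poly) auto
    then show "c t / real (card K choose card (S t)) * (\<Sum>j\<in>nodes d. node_weight d j * real (j choose card (S t))) = 0"
      by (simp add: P(2))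
  qed
  finally have zero: "(\<Sum>j\<in>nodes d. node_weight d j * p j) = 0" .
  have range: "p j \<in> {0..1}" if "j \<in> nodes d" for j
  proof -
    have F01: "0 \<le> F Z" "F Z \<le> 1" if "Z \<in> L j" for Z using bool[of Z] that by (auto simp: L_def)
    have "0 \<le> (\<Sum>Z\<in>L j. F Z)" by (intro sum_nonneg F01)
    moreover have "(\<Sum>Z\<in>L j. F Z) \<le> (\<Sum>Z\<in>L j. 1)" by (intro sum_mono F01)
    moreover have "0 < real (card K choose j)" using node_le[OF that] by simp
    ultimately show ?thesis by (simp add: p_def cardL divide_le_eq)
  qed
  have "L 0 = {{}}" using K by (auto simp: L_def finite_subset)
  then have p0: "p 0 = F {}" by (simp add: p_def)
  have "L 1 = (\<lambda>i. {i}) ` K" by (auto simp: L_def card_1_singleton_iff)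
  then have "(\<Sum>Z\<in>L 1. F Z) = (\<Sum>i\<in>K. F {i})" by (simp add: sum.reindex)
  \<comment> \<open>Having only two values, \<open>F\<close> is the same on all singletons, so
    averaging does not blur the jump.\<close>
  also have "\<dots> = (\<Sum>i\<in>K. 1 - F {})"
  proof (intro sum.cong refl)
    fix i assume i: "i \<in> K"
    show "F {i} = 1 - F {}" using sens[OF i] bool[of "{i}"] bool[of "{}"] i by auto
  qed
  finally have "p 1 = 1 - F {}"
    using node_le[of 1] by (simp add: p_def nodes_def)
  with p0 bool[of "{}"] have "\<bar>p 0 - p 1\<bar> = 1" by auto
  with node_not_alternating[of d p, OF d range] zero show False by blast
qed

text \<open>A set \<open>Z\<close> of blocks selects where \<open>x\<close> is replaced by the
  \<open>y M\<close>. Expanding the monomials at the resulting point turns \<open>f\<close> into a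
  combination of indicators that \<open>Z\<close> contains given blocks, at most \<open>d\<close> of
  them for each monomial.\<close>

lemma card_disjoint_sensitive_less:
  assumes bool: "boolean_fun n q f" and x: "x \<in> grid n q" and d: "1 \<le> d"
    and supp: "\<And>S. S \<in> supports n q f \<Longrightarrow> card S \<le> d"
    and fin: "finite \<M>" and disj: "pairwise disjnt \<M>"
    and y: "\<And>M. M \<in> \<M> \<Longrightarrow> y M \<in> grid n q \<and> f (override_on x (y M) M) \<noteq> f x"
  shows "card \<M> < 2 * d\<^sup>2"
proof -
  define H where "H = \<Union>\<M>"
  define blk where "blk = (\<lambda>i. THE M. M \<in> \<M> \<and> i \<in> M)"
  have blk_eq: "blk i = M" if "M \<in> \<M>" "i \<in> M" for i M
    unfolding blk_def
  proof (rule the_equality)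
    fix N assume "N \<in> \<M> \<and> i \<in> N"
    then show "N = M" using that disj by (auto simp: pairwise_def disjnt_def)
  qed (use that in auto)
  have blk_mem: "blk i \<in> \<M>" "i \<in> blk i" if "i \<in> H" for i
    using that blk_eq by (auto simp: H_def)
  define P where "P = (\<lambda>Z i. if i \<in> \<Union>Z then y (blk i) i else x i)"
  have P_grid: "P Z \<in> grid n q" if "Z \<subseteq> \<M>" for Z
  proof -
    have *: "y (blk i) \<in> grid n q" if "i \<in> \<Union>Z" for i
      using that \<open>Z \<subseteq> \<M>\<close> y blk_mem by (auto simp: H_def)
    then show ?thesis
      using x by (auto simp: P_def grid_def PiE_iff extensional_def)
  qed
  have P_empty: "P {} = x" by (simp add: P_def)
  have P_single: "P {M} = override_on x (y M) M" if "M \<in> \<M>" for M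
    using that blk_eq by (auto simp: P_def override_on_def)
  have mem_iff: "i \<in> \<Union>Z \<longleftrightarrow> blk i \<in> Z" if "Z \<subseteq> \<M>" "i \<in> H" for i Z
    using that blk_eq blk_mem by (metis UnionE UnionI subsetD)
  \<comment> \<open>At a coordinate in \<open>H\<close>, the power is its value at \<open>x\<close>
    plus \<open>D\<close> times the indicator that the block is switched on. Multiplying out, a pair
    \<open>(u, V)\<close> in \<open>I\<close> records the coordinates \<open>V\<close> at which the
    second term is chosen.\<close>
  define G where "G = {u \<in> grid n q. coeffs n q f u \<noteq> 0}"
  define D where "D = (\<lambda>u i. real (y (blk i) i) ^ u i - real (x i) ^ u i)"
  define c where "c = (\<lambda>(u, V). coeffs n q f u * ((\<Prod>i\<in>mono_supp n u - H. real (x i) ^ u i)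
      * ((\<Prod>i\<in>V. D u i) * (\<Prod>i\<in>(mono_supp n u \<inter> H) - V. real (x i) ^ u i))))"
  define I where "I = Sigma G (\<lambda>u. Pow (mono_supp n u \<inter> H))"
  have fin_ms: "finite (mono_supp n u)" for u by (simp add: mono_supp_def)
  have monomial_P: "monomial n u (P Z) = (\<Sum>V\<in>Pow (mono_supp n u \<inter> H).
      ((\<Prod>i\<in>mono_supp n u - H. real (x i) ^ u i)
      * ((\<Prod>i\<in>V. D u i) * (\<Prod>i\<in>(mono_supp n u \<inter> H) - V. real (x i) ^ u i))) * of_bool (blk ` V \<subseteq> Z))"
    if Z: "Z \<subseteq> \<M>" for u Z
  proof -
    have fin_V: "finite V" if "V \<in> Pow (mono_supp n u \<inter> H)" for V
      using that fin_ms[of u] finite_subset by blast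
    have "monomial n u (P Z) = (\<Prod>i\<in>mono_supp n u. real (P Z i) ^ u i)"
      unfolding monomial_def by (intro prod.mono_neutral_right) (auto simp: mono_supp_def)
    also have "\<dots> = (\<Prod>i\<in>mono_supp n u - H. real (P Z i) ^ u i) * (\<Prod>i\<in>mono_supp n u \<inter> H. real (P Z i) ^ u i)"
      using fin_ms[of u] by (subst prod.Int_Diff[of _ _ H]) (auto simp: mult.commute)
    also have "(\<Prod>i\<in>mono_supp n u - H. real (P Z i) ^ u i) = (\<Prod>i\<in>mono_supp n u - H. real (x i) ^ u i)"
      using Z by (intro prod.cong) (auto simp: P_def H_def)
    also have "(\<Prod>i\<in>mono_supp n u \<inter> H. real (P Z i) ^ u i)
        = (\<Prod>i\<in>mono_supp n u \<inter> H. of_bool (blk i \<in> Z) * D u i + real (x i) ^ u i)"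
    proof (intro prod.cong refl)
      fix i assume "i \<in> mono_supp n u \<inter> H"
      then have "P Z i = (if blk i \<in> Z then y (blk i) i else x i)"
        using mem_iff[OF Z, of i] by (simp only: P_def IntD2)
      then show "real (P Z i) ^ u i = of_bool (blk i \<in> Z) * D u i + real (x i) ^ u i"
        by (simp add: D_def)
    qed
    also have "\<dots> = (\<Sum>V\<in>Pow (mono_supp n u \<inter> H).
        (\<Prod>i\<in>V. of_bool (blk i \<in> Z) * D u i) * (\<Prod>i\<in>(mono_supp n u \<inter> H) - V. real (x i) ^ u i))"
      using fin_ms[of u] by (intro prod_add) auto
    also have "\<dots> = (\<Sum>V\<in>Pow (mono_supp n u \<inter> H). of_bool (blk ` V \<subseteq> Z) *
        ((\<Prod>i\<in>V. D u i) * (\<Prod>i\<in>(mono_supp n u \<inter> H) - V. real (x i) ^ u i)))"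
    proof (intro sum.cong refl)
      fix V assume V: "V \<in> Pow (mono_supp n u \<inter> H)"
      have "(\<Prod>i\<in>V. of_bool (blk i \<in> Z) :: real) = of_bool (blk ` V \<subseteq> Z)"
      proof (cases "blk ` V \<subseteq> Z")
        case False
        then have "(\<Prod>i\<in>V. of_bool (blk i \<in> Z) :: real) = 0"
          using fin_V[OF V] by (intro prod_zero) auto
        with False show ?thesis by simp
      qed (auto intro!: prod.neutral)
      then show "(\<Prod>i\<in>V. of_bool (blk i \<in> Z) * D u i) * (\<Prod>i\<in>(mono_supp n u \<inter> H) - V. real (x i) ^ u i)
          = of_bool (blk ` V \<subseteq> Z) * ((\<Prod>i\<in>V. D u i) * (\<Prod>i\<in>(mono_supp n u \<inter> H) - V. real (x i) ^ u i))"
        by (simp add: prod.distrib)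
    qed
    finally show ?thesis by (simp only: sum_distrib_left mult_ac)
  qed
  show ?thesis
  proof (rule card_sensitive_less[where F = "\<lambda>Z. f (P Z)" and I = I and c = c and S = "\<lambda>(u, V). blk ` V"])
    fix t assume "t \<in> I"
    then obtain u V where t: "t = (u, V)" "u \<in> G" "V \<subseteq> mono_supp n u \<inter> H" by (auto simp: I_def)
    have "card (blk ` V) \<le> card V" using t(3) fin_ms by (intro card_image_le) (auto intro: finite_subset)
    also have "\<dots> \<le> card (mono_supp n u)" using t(3) fin_ms by (intro card_mono) auto
    also have "\<dots> \<le> d" using t(2) by (intro supp) (auto simp: supports_def G_def)
    finally show "(case t of (u, V) \<Rightarrow> blk ` V) \<subseteq> \<M> \<and> card (case t of (u, V) \<Rightarrow> blk ` V) \<le> d"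
      using t blk_mem by auto
  next
    fix Z assume Z: "Z \<subseteq> \<M>"
    show "f (P Z) \<in> {0, 1}" using bool P_grid[OF Z] by (auto simp: boolean_fun_def)
    have "f (P Z) = (\<Sum>u\<in>grid n q. coeffs n q f u * monomial n u (P Z))"
      by (rule fun_expansion[OF P_grid[OF Z]])
    also have "\<dots> = (\<Sum>u\<in>G. coeffs n q f u * monomial n u (P Z))"
      by (intro sum.mono_neutral_right) (auto simp: G_def)
    also have "\<dots> = (\<Sum>u\<in>G. \<Sum>V\<in>Pow (mono_supp n u \<inter> H). c (u, V) * of_bool (blk ` V \<subseteq> Z))"
      unfolding monomial_P[OF Z] sum_distrib_left c_def prod.case by (simp only: mult.assoc)
    also have "\<dots> = (\<Sum>(u, V)\<in>I. c (u, V) * of_bool (blk ` V \<subseteq> Z))"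
      unfolding I_def using fin_ms by (intro sum.Sigma) (auto simp: G_def)
    finally show "f (P Z) = (\<Sum>t\<in>I. c t * of_bool ((case t of (u, V) \<Rightarrow> blk ` V) \<subseteq> Z))"
      by (simp add: case_prod_unfold)
  next
    fix M assume "M \<in> \<M>"
    then show "f (P {M}) \<noteq> f (P {})" using y P_single P_empty by simp
  qed (use fin d in auto)
qed

section \<open>The bound\<close>

text \<open>\<open>H\<close> is the union of a maximal disjoint family of supports of size
  \<open>d\<close>: fewer than 2 d^2 blocks with \<open>d\<close> elements each.\<close>

lemma hitting_set_ex:
  assumes bool: "boolean_fun n q f" and q: "q > 0" and d: "1 \<le> d"
    and supp: "\<And>S. S \<in> supports n q f \<Longrightarrow> card S \<le> d"
  obtains H where "H \<subseteq> {..<n}" "card H \<le> 2 * d ^ 3"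
    "\<And>S. S \<in> supports n q f \<Longrightarrow> card S = d \<Longrightarrow> S \<inter> H \<noteq> {}"
    "\<And>i. i \<in> H \<Longrightarrow> \<exists>S\<in>supports n q f. i \<in> S \<and> card S = d"
proof -
  define Top where "Top = {S \<in> supports n q f. card S = d}"
  define A where "A = {\<M>. \<M> \<subseteq> Top \<and> pairwise disjnt \<M>}"
  have finTop: "finite Top" by (simp add: Top_def)
  then have "finite A" unfolding A_def by (auto intro: finite_subset[of _ "Pow Top"])
  moreover have "{} \<in> A" by (simp add: A_def)
  ultimately obtain \<M> where \<M>: "\<M> \<in> A" "\<And>\<N>. \<N> \<in> A \<Longrightarrow> \<M> \<subseteq> \<N> \<Longrightarrow> \<M> = \<N>"
    using finite_has_maximal[of A] by blast
  define x where "x = (\<lambda>i\<in>{..<n}. 0::nat)"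
  have x: "x \<in> grid n q" using q by (auto simp: x_def grid_def)
  have sub: "\<M> \<subseteq> Top" and disj: "pairwise disjnt \<M>" using \<M>(1) by (auto simp: A_def)
  have fin: "finite \<M>" using sub finTop finite_subset by blast
  have "\<exists>z\<in>grid n q. f (override_on x z M) \<noteq> f x" if "M \<in> \<M>" for M
  \<comment> \<open>A support of the largest allowed size cannot be properly contained in
    another.\<close>
  proof (rule sensitive_maximal_support[OF x])
    show M: "M \<in> supports n q f" "M \<noteq> {}" using that sub d by (auto simp: Top_def)
    fix T assume T: "T \<in> supports n q f"
    have "finite T" using supports_subset[OF T] finite_subset by blast
    moreover have "card M = d" using that sub by (auto simp: Top_def)
    ultimately show "\<not> M \<subset> T" using supp[OF T] psubset_card_mono[of T M] by linarith
  qed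
  then obtain y where y: "\<And>M. M \<in> \<M> \<Longrightarrow> y M \<in> grid n q \<and> f (override_on x (y M) M) \<noteq> f x"
    by metis
  have "card \<M> < 2 * d\<^sup>2"
    by (rule card_disjoint_sensitive_less[OF bool x d supp fin disj y])
  then have "d * card \<M> \<le> d * (2 * d\<^sup>2)" by (intro mult_le_mono2) simp
  moreover have "card (\<Union>\<M>) \<le> (\<Sum>M\<in>\<M>. card M)" by (rule card_Union_le_sum_card)
  moreover have "(\<Sum>M\<in>\<M>. card M) = d * card \<M>" using sub by (simp add: Top_def subset_iff)
  ultimately have "card (\<Union>\<M>) \<le> d * (2 * d\<^sup>2)"
    by linarith
  then have card: "card (\<Union>\<M>) \<le> 2 * d ^ 3" by (simp add: power2_eq_square power3_eq_cube)
  show thesis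
  proof (rule that)
    show "\<Union>\<M> \<subseteq> {..<n}" using sub supports_subset by (fastforce simp: Top_def)
    show "card (\<Union>\<M>) \<le> 2 * d ^ 3" by (rule card)
    show "\<exists>S\<in>supports n q f. i \<in> S \<and> card S = d" if "i \<in> \<Union>\<M>" for i
      using that sub by (auto simp: Top_def)
    fix S assume S: "S \<in> supports n q f" "card S = d"
    show "S \<inter> \<Union>\<M> \<noteq> {}"
    proof
      assume emp: "S \<inter> \<Union>\<M> = {}"
      then have "disjnt S M" if "M \<in> \<M>" for M using that by (auto simp: disjnt_def)
      \<comment> \<open>By maximality \<open>S\<close> would already be a member; being disjoint
        from the union, it would be empty, contradicting \<open>d\<close> >= 1.\<close>
      then have "insert S \<M> \<in> A"
        using disj sub S by (auto simp: A_def Top_def pairwise_insert disjnt_sym)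
      then have "S \<in> \<M>" using \<M>(2) by blast
      with emp have "S = {}" by blast
      with S d show False by simp
    qed
  qed
qed

text \<open>The new term of the sum pays for the variables in the hitting set \<open>H\<close>; all
  other variables are bounded through the restrictions that fix \<open>H\<close>.\<close>

lemma sum_var_weight_le:
  assumes "boolean_fun n q f" "q > 0" "\<And>S. S \<in> supports n q f \<Longrightarrow> card S \<le> d"
  shows "(\<Sum>i<n. var_weight n q f i) \<le> (\<Sum>k=1..d. 2 * real k ^ 3 / real q ^ k)"
  using assms
proof (induction d arbitrary: f)
  case 0
  have "var_weight n q f i = 0" for i
  proof -
    have "i \<notin> S" if S: "S \<in> supports n q f" for S
    proof -
      have "finite S" using supports_subset[OF S] finite_subset by blast
      then show ?thesis using 0(3)[OF S] by auto
    qed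
    then show ?thesis by (auto simp: var_weight_def)
  qed
  then show ?case by simp
next
  case (Suc d)
  obtain H where H: "H \<subseteq> {..<n}" "card H \<le> 2 * Suc d ^ 3"
    "\<And>S. S \<in> supports n q f \<Longrightarrow> card S = Suc d \<Longrightarrow> S \<inter> H \<noteq> {}"
    "\<And>i. i \<in> H \<Longrightarrow> \<exists>S\<in>supports n q f. i \<in> S \<and> card S = Suc d"
    by (rule hitting_set_ex[OF Suc.prems(1,2) _ Suc.prems(3)]) auto
  have finH: "finite H" using H(1) finite_subset by blast
  have "var_weight n q f i \<le> 1 / real q ^ Suc d" if i: "i \<in> H" for i
  proof -
    obtain S where S: "S \<in> supports n q f" "i \<in> S" "card S = Suc d" using H(4)[OF i] by blast
    have "real q ^ Suc d \<le> real q ^ var_deg n q f i"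
      using var_deg_ge[OF S(1,2)] S(3) Suc.prems(2) by (intro power_increasing) auto
    then have "1 / real q ^ var_deg n q f i \<le> 1 / real q ^ Suc d"
      using Suc.prems(2) by (intro divide_left_mono) auto
    then show ?thesis by (auto simp: var_weight_def)
  qed
  then have "(\<Sum>i\<in>H. var_weight n q f i) \<le> real (card H) * (1 / real q ^ Suc d)"
    by (rule sum_bounded_above)
  also have "\<dots> \<le> real (2 * Suc d ^ 3) * (1 / real q ^ Suc d)"
    using H(2) by (intro mult_right_mono) (auto simp del: of_nat_mult of_nat_power)
  finally have onH: "(\<Sum>i\<in>H. var_weight n q f i) \<le> 2 * real (Suc d) ^ 3 / real q ^ Suc d"
    by simp
  have offH: "(\<Sum>i\<in>{..<n} - H. var_weight n q f i) \<le> (\<Sum>k=1..d. 2 * real k ^ 3 / real q ^ k)"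
  proof (rule sum_var_weight_restr_le[OF finH H(1) _ Suc.prems(2)])
    fix a assume a: "a \<in> grid n q"
    \<comment> \<open>A support of size \<open>Suc d\<close> meets \<open>H\<close> and therefore
      loses an element.\<close>
    have "card S \<le> d" if S: "S \<in> supports n q (restr H a f)" for S
    proof -
      obtain T where T: "T \<in> supports n q f" "S = T - H"
        using supports_restr[OF finH H(1) a S] by blast
      have "finite T" using supports_subset[OF T(1)] finite_subset by blast
      show ?thesis
      proof (cases "card T = Suc d")
        case True
        then have "S \<subset> T" using H(3)[OF T(1)] T(2) by blast
        then show ?thesis using psubset_card_mono[OF \<open>finite T\<close>, of S] True by simp
      next
        case False
        then have "card T \<le> d" using Suc.prems(3)[OF T(1)] by simp
        moreover have "card S \<le> card T" using T(2) \<open>finite T\<close> by (intro card_mono) auto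
        ultimately show ?thesis by simp
      qed
    qed
    then have "(\<Sum>i<n. var_weight n q (restr H a f) i) \<le> (\<Sum>k=1..d. 2 * real k ^ 3 / real q ^ k)"
      by (intro Suc.IH boolean_restr a Suc.prems)
    moreover have "(\<Sum>i\<in>{..<n} - H. var_weight n q (restr H a f) i) \<le> (\<Sum>i<n. var_weight n q (restr H a f) i)"
      by (intro sum_mono2) (auto simp: var_weight_nonneg)
    ultimately show "(\<Sum>i\<in>{..<n} - H. var_weight n q (restr H a f) i) \<le> (\<Sum>k=1..d. 2 * real k ^ 3 / real q ^ k)"
      by linarith
  qed auto
  have "(\<Sum>i<n. var_weight n q f i) = (\<Sum>i\<in>{..<n} - H. var_weight n q f i) + (\<Sum>i\<in>H. var_weight n q f i)"
    using H(1) by (intro sum.subset_diff) auto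
  with onH offH show ?case by simp
qed

section \<open>Summing k^3 / q^k\<close>

text \<open>The long fraction is the closed form of the tail over k > d, so both sides are the full
  series; dropping this nonnegative tail gives the bound below.\<close>

lemma sum_cubes_geometric:
  fixes q :: real
  assumes "q > 1"
  shows "(\<Sum>k=1..d. real k ^ 3 / q ^ k)
       + (real d ^ 3 * (q - 1) ^ 3 + 3 * real d ^ 2 * q * (q - 1) ^ 2 + 3 * real d * q * (q + 1) * (q - 1)
          + q * (q\<^sup>2 + 4 * q + 1)) / ((q - 1) ^ 4 * q ^ d)
     = q * (q\<^sup>2 + 4 * q + 1) / (q - 1) ^ 4"
proof (induction d)
  case (Suc d)
  \<comment> \<open>\<open>N t / (q - 1)^4\<close> is the sum of \<open>(t + k)^3 / q^k\<close> over all \<open>k \<ge> 1\<close>.\<close>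
  define N where "N = (\<lambda>t::real. t ^ 3 * (q - 1) ^ 3 + 3 * t ^ 2 * q * (q - 1) ^ 2 + 3 * t * q * (q + 1) * (q - 1)
          + q * (q\<^sup>2 + 4 * q + 1))"
  have rec: "t ^ 3 * (q - 1) ^ 4 + N t = q * N (t - 1)" for t
    unfolding N_def by algebra
  have "real (Suc d) ^ 3 / q ^ Suc d + N (real (Suc d)) / ((q - 1) ^ 4 * q ^ Suc d)
      = (real (Suc d) ^ 3 * (q - 1) ^ 4 + N (real (Suc d))) / ((q - 1) ^ 4 * q ^ Suc d)"
    using assms by (simp only: divide_simps) simp
  also have "\<dots> = N (real d) / ((q - 1) ^ 4 * q ^ d)"
    unfolding rec using assms by simp
  finally show ?case
    using Suc.IH unfolding N_def by (simp only: sum.cl_ivl_Suc) simp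
qed simp

lemma sum_cubes_geometric_le:
  fixes q :: real
  assumes "q > 1"
  shows "(\<Sum>k=1..d. 2 * real k ^ 3 / q ^ k) \<le> 2 * q * (q\<^sup>2 + 4 * q + 1) / (q - 1) ^ 4"
proof -
  have "0 \<le> (real d ^ 3 * (q - 1) ^ 3 + 3 * real d ^ 2 * q * (q - 1) ^ 2 + 3 * real d * q * (q + 1) * (q - 1)
          + q * (q\<^sup>2 + 4 * q + 1)) / ((q - 1) ^ 4 * q ^ d)"
    using assms by (intro divide_nonneg_nonneg add_nonneg_nonneg mult_nonneg_nonneg) auto
  then have "(\<Sum>k=1..d. real k ^ 3 / q ^ k) \<le> q * (q\<^sup>2 + 4 * q + 1) / (q - 1) ^ 4"
    using sum_cubes_geometric[OF assms, of d] by linarith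
  moreover have "(\<Sum>k=1..d. 2 * real k ^ 3 / q ^ k) = 2 * (\<Sum>k=1..d. real k ^ 3 / q ^ k)"
    by (simp add: sum_distrib_left)
  ultimately show ?thesis by simp
qed

lemma num_relevant_bound:
  assumes "q \<ge> 2" "boolean_fun n q f" "deg n q f \<le> d"
  shows "real (num_relevant n q f)
    \<le> 2 * real q * ((real q)\<^sup>2 + 4 * real q + 1) / (real q - 1) ^ 4 * real q ^ d"
proof -
  have supp: "card S \<le> d" if "S \<in> supports n q f" for S
    using card_supports_le[OF that] assms(3) by simp
  have "real (num_relevant n q f) \<le> real q ^ d * (\<Sum>i<n. var_weight n q f i)"
    using assms(1) by (intro num_relevant_le supp) auto
  also have "\<dots> \<le> real q ^ d * (\<Sum>k=1..d. 2 * real k ^ 3 / real q ^ k)"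
    using assms(1) by (intro mult_left_mono sum_var_weight_le assms(2) supp) auto
  also have "\<dots> \<le> real q ^ d * (2 * real q * ((real q)\<^sup>2 + 4 * real q + 1) / (real q - 1) ^ 4)"
    using assms(1) by (intro mult_left_mono sum_cubes_geometric_le) auto
  finally show ?thesis by (simp only: mult.commute)
qed

theorem theorem1:
  fixes q d :: nat
  assumes "q \<ge> 3"
  shows "ereal_of_enat (max_relevant d q) \<le>
    ereal (2 * real q * ((real q)^2 + 4 * real q + 1) / (real q - 1)^4 * real q ^ d)"
proof -
  let ?B = "2 * real q * ((real q)^2 + 4 * real q + 1) / (real q - 1)^4 * real q ^ d"
  have B: "?B \<ge> 0" by simp
  \<comment> \<open>The supremum is taken in \<open>enat\<close>, so the real bound is first rounded
    down to a natural number.\<close>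
  have "max_relevant d q \<le> enat (nat \<lfloor>?B\<rfloor>)"
    unfolding max_relevant_def
  proof (rule Sup_least)
    fix e assume "e \<in> {enat (num_relevant n q f) | n f. n > 0 \<and> boolean_fun n q f \<and> deg n q f \<le> d}"
    then obtain n f where e: "e = enat (num_relevant n q f)" "boolean_fun n q f" "deg n q f \<le> d"
      by blast
    have "real (num_relevant n q f) \<le> ?B"
      using assms by (intro num_relevant_bound e) auto
    then show "e \<le> enat (nat \<lfloor>?B\<rfloor>)"
      unfolding e(1) enat_ord_simps by (rule le_nat_floor)
  qed
  then have "ereal_of_enat (max_relevant d q) \<le> ereal_of_enat (enat (nat \<lfloor>?B\<rfloor>))"
    by (simp only: ereal_of_enat_le_iff)
  also have "\<dots> \<le> ereal ?B"
    using of_nat_floor[OF B] by simp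
  finally show ?thesis .
qed

end
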